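(* Let $K$ be a sufficiently large (fixed) positive constant, let $\delta>0$ be suitably small, let $N^{1/2+\delta}\le Q\le N$, and let $Q_0$ be a real number such that $$K\sqrt{N\log N}\le Q\le N\quad\text{and}\quad \frac{N\log N}{Q}\le Q_0\le \frac{Q}{K^2}.$$ Let $\mathfrak{m}=\mathfrak{m}(K,Q_0,Q)$ be the corresponding set of minor arcs, and let $N$ be sufficiently large in terms of $\delta$. Then the following upper bounds hold (for both $\varpi=\omega$ and $\varpi=\Omega$), with implied constants depending at most on $\delta$ and $K$. (a) $$\int_{\mathfrak{m}}|\mathcal{S}_1(\theta)|^2\,d\theta\ll Q.$$ (b) If $KQ_0<N^{1/2-\delta/2}$, then $$\int_{\mathfrak{m}}|\mathcal{S}_{\varpi}(\theta)|^2\,d\theta\ll Q(\log\log N)^2+N\log\left(\frac{\log N}{\log(2N/Q)}\right).$$ (c) Let $R(N)$ be a non-zero real function of $N$ and $\alpha_N=1+1/R(N)$. There exists a large constant $C=C(\delta)>0$ such that if $KQ_0<N^{1/2-\delta/2}$, $C\log\log N<|R(N)|\le N^{\delta/12}$ and $|R(N)|>(\log\log N)^{3/2}$, then $$\int_{\mathfrak{m}}|\mathcal{S}_{d_{\alpha_N}^{\varpi}}(\theta)|^2\,d\theta\ll \frac{N}{R(N)^2}\log\left(\frac{\log N}{\log(2N/Q)}\right)+Q.$$ (d) Let $u:=(\log N)/(\log y)$. There exists a large constant $C>0$ such that if $KQ_0\le N^{1/2-\delta}(\log N)^{17}$ and $1+\frac{\log C}{\log N}\le u\le 2$, then $$\int_{\mathfrak{m}}|\mathcal{S}_{\mathbf{1}_{y\text{-smooth}}}(\theta)|^2\,d\theta\ll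 N\log u+Q.$$
   Context: The major arcs $\mathfrak{M}=\mathfrak{M}(K,Q_0,Q)$ consist of those $\theta\in\mathbb{R}/\mathbb{Z}$ for which there are a positive integer $q\le KQ_0$ and a reduced residue class $a$ modulo $q$ (i.e. $(a,q)=1$) with $|\theta-a/q|\le K/(qQ)$. The minor arcs $\mathfrak{m}=\mathfrak{m}(K,Q_0,Q)$ are the complement of $\mathfrak{M}$ in $\mathbb{R}/\mathbb{Z}$. For an arithmetic function $f$, $\mathcal{S}_f(\theta):=\sum_{n\le N}f(n)e(n\theta)$ with $e(t)=e^{2\pi i t}$; $\mathcal{S}_1$ is the case $f=1$. $\omega(n)$ and $\Omega(n)$ denote the number of prime divisors of $n$ counted without and with multiplicity, respectively; $\varpi$ denotes either one, and $d_{\alpha_N}^{\varpi}(n):=\alpha_N^{\varpi(n)}$. $\mathbf{1}_{y\text{-smooth}}$ is the indicator function of the positive integers all of whose prime factors $p$ satisfy $p\le y$. *)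

theory Defs
  imports "HOL-Analysis.Analysis" "HOL-Computational_Algebra.Computational_Algebra"
begin

definition e_unit :: "real \<Rightarrow> complex" where
  "e_unit t = exp (2 * complex_of_real pi * \<i> * complex_of_real t)"

text \<open>
  \<open>\<real>/\<int>\<close> is represented by its fundamental domain \<open>[0, 1)\<close>. In the major arcs, \<open>a\<close> ranges over all
  integers coprime to \<open>q\<close> rather than over representatives of the reduced classes, so that
  \<open>\<exists>a. \<bar>\<theta> - a/q\<bar> \<le> K/(qQ)\<close> expresses closeness modulo 1: for instance, both ends of \<open>[0, 1)\<close> are
  close to the class of \<open>0\<close>.
\<close>

definition circle :: "real set" where
  "circle = {0..<1}"

definition major_arcs :: "real \<Rightarrow> real \<Rightarrow> real \<Rightarrow> real set" where
  "major_arcs K Q0 Q =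
     {\<theta> \<in> circle. \<exists>(q::nat) (a::int). 0 < q \<and> real q \<le> K * Q0 \<and> coprime a (int q) \<and>
        \<bar>\<theta> - real_of_int a / real q\<bar> \<le> K / (real q * Q)}"

definition minor_arcs :: "real \<Rightarrow> real \<Rightarrow> real \<Rightarrow> real set" where
  "minor_arcs K Q0 Q = circle - major_arcs K Q0 Q"

definition exp_sum :: "(nat \<Rightarrow> complex) \<Rightarrow> real \<Rightarrow> real \<Rightarrow> complex" where
  "exp_sum f N \<theta> = (\<Sum>n | 1 \<le> n \<and> real n \<le> N. f n * e_unit (real n * \<theta>))"

definition minor_integral :: "(nat \<Rightarrow> complex) \<Rightarrow> real \<Rightarrow> real \<Rightarrow> real \<Rightarrow> real \<Rightarrow> real" where
  "minor_integral f N K Q0 Q =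
     (LINT \<theta>:minor_arcs K Q0 Q|lborel. (cmod (exp_sum f N \<theta>))\<^sup>2)"

definition little_omega :: "nat \<Rightarrow> nat" where
  "little_omega n = card (prime_factors n)"

definition big_omega :: "nat \<Rightarrow> nat" where
  "big_omega n = size (prime_factorization n)"

definition smooth_indicator :: "real \<Rightarrow> nat \<Rightarrow> complex" where
  "smooth_indicator y n = (if 0 < n \<and> (\<forall>p. prime p \<and> p dvd n \<longrightarrow> real p \<le> y) then 1 else 0)"

definition admissible :: "real \<Rightarrow> real \<Rightarrow> real \<Rightarrow> real \<Rightarrow> real \<Rightarrow> bool" where
  "admissible K \<delta> N Q Q0 \<longleftrightarrow>
     N powr (1/2 + \<delta>) \<le> Q \<and> Q \<le> N \<and>
     K * sqrt (N * ln N) \<le> Q \<and>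
     N * ln N / Q \<le> Q0 \<and> Q0 \<le> Q / K\<^sup>2"

end

theory Submission
  imports Defs
begin

text \<open>
  Approximate the arithmetic function \<open>f\<close> by a short divisor sum: \<open>f n = (\<Sum>i. d i dvd n. g i) + h n\<close>
  with all \<open>d i \<le> K * Q0\<close>. On the minor arcs \<open>d \<theta>\<close> stays at distance at least \<open>K / Q\<close> from the
  integers for every \<open>d \<le> K * Q0\<close>, so the geometric sum over the multiples of \<open>d\<close> is dominated by
  a geometric series with ratio of modulus \<open>1 - 1 / Q\<close>, whose mean square over the circle is at
  most \<open>Q\<close>. Parseval's identity on the whole circle takes care of \<open>h\<close>, so that the integral is
  \<open>O(Q (\<Sum>\<bar>g i\<bar>)\<^sup>2 + \<Sum>(h n)\<^sup>2)\<close>.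

  For \<open>\<omega>\<close> and \<open>\<Omega>\<close> the divisors are 1 and the primes up to \<open>y = (2 N / Q) powr (1/4)\<close>; the number of
  prime factors above \<open>y\<close> is replaced by its mean \<open>L\<close> (the weight of the divisor 1), and its variance
  is controlled by Turan's inequality. For \<open>\<alpha> ^ \<omega>\<close> one replaces the contribution of the primes above
  \<open>y\<close> by \<open>\<alpha> powr L\<close> and expands that of the primes up to \<open>y\<close> to second order in \<open>1 / R\<close>; the cubic remainder
  has mean square \<open>(ln (ln N)) ^ 6 / R ^ 6 \<le> 1 / R\<^sup>2\<close>, which is where the exponent \<open>3/2\<close> is used.
  For smooth numbers the divisor 1 suffices, by Chebyshev's bound for the primes between \<open>y\<close> and \<open>N\<close>.
\<close>

section \<open>Exponential sums on the minor arcs\<close>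

lemma e_unit_eq_cis: "e_unit t = cis (2 * pi * t)"
  by (simp add: e_unit_def cis_conv_exp mult_ac)

lemma norm_e_unit [simp]: "cmod (e_unit t) = 1"
  by (simp add: e_unit_eq_cis)

lemma e_unit_add: "e_unit (s + t) = e_unit s * e_unit t"
  by (simp add: e_unit_eq_cis cis_mult ring_distribs)

lemma cnj_e_unit: "cnj (e_unit t) = e_unit (- t)"
  by (simp add: e_unit_eq_cis cis_cnj)

lemma e_unit_of_int [simp]: "e_unit (of_int k) = 1"
  using cis_multiple_2pi[of "of_int k"] by (simp add: e_unit_eq_cis)

lemma e_unit_nat_mult: "e_unit (real n * t) = e_unit t ^ n"
  by (simp add: e_unit_eq_cis Complex.DeMoivre algebra_simps)

text \<open>Up to \<open>pi / 3\<close> the derivative \<open>cos t - 1 / 2\<close> of the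
  difference is nonnegative. Beyond that point \<open>sin t\<close> is at least
  \<open>sqrt 3 / 2 > 0.85\<close>, while \<open>t / 2\<close> stays below 0.8.\<close>

lemma sin_ge_half: 
  assumes "0 \<le> t" "t \<le> pi / 2"
  shows "t / 2 \<le> sin t"
proof (cases "t \<le> pi / 3")
  case True
  have "sin 0 - 0 / 2 \<le> sin t - t / 2"
  proof (rule DERIV_nonneg_imp_nondecreasing[where f = "\<lambda>t. sin t - t / 2"])
    fix x assume x: "0 \<le> x" "x \<le> t"
    have "cos (pi / 3) \<le> cos x"
      using x True by (intro cos_monotone_0_pi_le) auto
    then have "0 \<le> cos x - 1 / 2" by (simp add: cos_60)
    moreover have "((\<lambda>t. sin t - t / 2) has_real_derivative cos x - 1 / 2) (at x)"
      by (auto intro!: derivative_eq_intros)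
    ultimately show "\<exists>y. ((\<lambda>t. sin t - t / 2) has_real_derivative y) (at x) \<and> 0 \<le> y"
      by blast
  qed (use assms in auto)
  then show ?thesis by simp
next
  case False
  have "sin (pi / 3) \<le> sin t"
    using False assms by (intro sin_monotone_2pi_le) auto
  moreover have "sqrt 3 / 2 \<ge> (0.85::real)"
    using real_le_rsqrt[of "1.7" 3] by (simp add: power2_eq_square)
  moreover have "pi < 3.2" using pi_less_4 pi_approx by simp
  ultimately show ?thesis using assms by (simp add: sin_60)
qed

text \<open>The chord has length \<open>2 * \<bar>sin (pi * s)\<bar>\<close>, which is at least
  \<open>pi * \<bar>s\<bar>\<close> by \<open>sin_ge_half\<close>; the 3 is \<open>pi\<close>
  rounded down.\<close>

lemma norm_one_minus_e_unit:
  assumes "\<bar>s\<bar> \<le> 1/2"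
  shows "3 * \<bar>s\<bar> \<le> cmod (1 - e_unit s)"
proof -
  have "cmod (1 - e_unit s) = 2 * \<bar>sin (pi * s)\<bar>"
  proof -
    have "(cmod (1 - e_unit s))\<^sup>2 = (1 - cos (2 * (pi * s)))\<^sup>2 + (sin (2 * (pi * s)))\<^sup>2"
      by (simp add: cmod_power2 e_unit_eq_cis mult.assoc)
    also have "\<dots> = (2 * sin (pi * s))\<^sup>2"
      using sin_cos_squared_add[of "pi * s"] unfolding cos_double_sin sin_double by algebra
    finally have "cmod (1 - e_unit s) = \<bar>2 * sin (pi * s)\<bar>"
      by (metis norm_ge_zero real_sqrt_abs abs_of_nonneg)
    then show ?thesis by simp
  qed
  moreover have "pi * \<bar>s\<bar> / 2 \<le> sin (pi * \<bar>s\<bar>)"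
    using assms by (intro sin_ge_half) auto
  moreover have "\<bar>sin (pi * s)\<bar> \<ge> sin (pi * \<bar>s\<bar>)"
    by (cases "s \<ge> 0") auto
  moreover have "3 * \<bar>s\<bar> \<le> pi * \<bar>s\<bar>"
    using pi_gt3 by (intro mult_right_mono) auto
  ultimately show ?thesis by linarith
qed

section \<open>Orthogonality of the characters and Parseval's identity\<close>

lemma has_integral_e_unit:
  "((\<lambda>\<theta>. e_unit (of_int k * \<theta>)) has_integral (if k = 0 then 1 else 0)) {0..1}"
proof (cases "k = 0")
  case True
  have "e_unit 0 = 1" using e_unit_of_int[of 0] by simp
  then show ?thesis using has_integral_const_real[of "1::complex" 0 1] True by simp
next
  case False
  define c where "c = 2 * complex_of_real pi * \<i> * of_int k"
  have c: "c \<noteq> 0" using False by (simp add: c_def)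
  have eq: "e_unit (of_int k * \<theta>) = exp (c * of_real \<theta>)" for \<theta>
    by (simp add: e_unit_def c_def mult_ac)
  have "((\<lambda>\<theta>. exp (c * of_real \<theta>)) has_integral (exp (c * of_real 1) / c - exp (c * of_real 0) / c)) {0..1}"
  proof (rule fundamental_theorem_of_calculus)
    fix x :: real
    have "((\<lambda>z. exp (c * z) / c) has_field_derivative exp (c * of_real x)) (at (of_real x))"
      using c by (auto intro!: derivative_eq_intros)
    then show "((\<lambda>x. exp (c * of_real x) / c) has_vector_derivative exp (c * of_real x)) (at x within {0..1})"
      by (rule has_vector_derivative_real_field)
  qed simp
  moreover have "exp (c * of_real 1) = 1"
    using eq[of 1] e_unit_of_int[of k] by simp
  ultimately show ?thesis using False by (simp add: eq)
qed

text \<open>Expanding the square gives a double sum whose off-diagonal terms integrate to 0 by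
  orthogonality. Frequencies are given by an injective map \<open>\<nu>\<close>, so that the
  identity covers both \<open>n\<close> itself and the multiples \<open>d i * k\<close> of a fixed
  divisor.\<close>

lemma parseval_has_integral:
  fixes a :: "'i \<Rightarrow> complex" and \<nu> :: "'i \<Rightarrow> nat"
  assumes "finite A" "inj_on \<nu> A"
  shows "((\<lambda>\<theta>. (cmod (\<Sum>k\<in>A. a k * e_unit (real (\<nu> k) * \<theta>)))\<^sup>2) has_integral
            (\<Sum>k\<in>A. (cmod (a k))\<^sup>2)) {0..1}"
proof -
  let ?F = "\<lambda>\<theta>. \<Sum>j\<in>A. \<Sum>k\<in>A. (a j * cnj (a k)) * e_unit (of_int (int (\<nu> j) - int (\<nu> k)) * \<theta>)"
  have "(?F has_integral (\<Sum>j\<in>A. \<Sum>k\<in>A. (a j * cnj (a k)) *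
           (if int (\<nu> j) - int (\<nu> k) = 0 then 1 else 0))) {0..1}"
    by (intro has_integral_sum has_integral_mult_right has_integral_e_unit assms)
  also have "(\<Sum>j\<in>A. \<Sum>k\<in>A. (a j * cnj (a k)) * (if int (\<nu> j) - int (\<nu> k) = 0 then 1 else 0))
      = (\<Sum>j\<in>A. \<Sum>k\<in>A. if j = k then a j * cnj (a k) else 0)"
    using assms(2) by (intro sum.cong refl) (auto dest: inj_onD)
  also have "\<dots> = (\<Sum>j\<in>A. a j * cnj (a j))"
    using assms(1) by simp
  finally have 1: "(?F has_integral (\<Sum>j\<in>A. a j * cnj (a j))) {0..1}" .
  have 2: "Re (?F \<theta>) = (cmod (\<Sum>k\<in>A. a k * e_unit (real (\<nu> k) * \<theta>)))\<^sup>2" for \<theta>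
  proof -
    have "?F \<theta> = (\<Sum>j\<in>A. a j * e_unit (real (\<nu> j) * \<theta>)) * cnj (\<Sum>k\<in>A. a k * e_unit (real (\<nu> k) * \<theta>))"
      unfolding cnj_sum sum_product
    proof (intro sum.cong refl)
      fix j k
      have "of_int (int (\<nu> j) - int (\<nu> k)) * \<theta> = real (\<nu> j) * \<theta> + - (real (\<nu> k) * \<theta>)"
        by (simp add: algebra_simps)
      then show "(a j * cnj (a k)) * e_unit (of_int (int (\<nu> j) - int (\<nu> k)) * \<theta>) =
          a j * e_unit (real (\<nu> j) * \<theta>) * cnj (a k * e_unit (real (\<nu> k) * \<theta>))"
        by (simp only: e_unit_add complex_cnj_mult cnj_e_unit mult_ac)
    qed
    then show ?thesis by (simp only: complex_norm_square[symmetric] Re_complex_of_real)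
  qed
  have 3: "Re (\<Sum>j\<in>A. a j * cnj (a j)) = (\<Sum>k\<in>A. (cmod (a k))\<^sup>2)"
    by (simp only: complex_norm_square[symmetric] Re_sum Re_complex_of_real)
  show ?thesis
    using has_integral_linear[OF 1 bounded_linear_Re] unfolding o_def 2 3 .
qed

lemma continuous_on_e_unit [continuous_intros]:
  "continuous_on S f \<Longrightarrow> continuous_on S (\<lambda>x. e_unit (f x))"
  unfolding e_unit_def by (intro continuous_intros)

text \<open>Transfers the identity to the Lebesgue integral, the one in which
  \<open>minor_integral\<close> is defined.\<close>

lemma parseval:
  fixes a :: "'i \<Rightarrow> complex" and \<nu> :: "'i \<Rightarrow> nat"
  assumes "finite A" "inj_on \<nu> A"
  shows "set_integrable lborel {0..1} (\<lambda>\<theta>. (cmod (\<Sum>k\<in>A. a k * e_unit (real (\<nu> k) * \<theta>)))\<^sup>2)" (is ?I)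
    and "(LINT \<theta>:{0..1}|lborel. (cmod (\<Sum>k\<in>A. a k * e_unit (real (\<nu> k) * \<theta>)))\<^sup>2) =
           (\<Sum>k\<in>A. (cmod (a k))\<^sup>2)"
proof -
  show ?I
    by (intro borel_integrable_atLeastAtMost' continuous_intros)
  then show "(LINT \<theta>:{0..1}|lborel. (cmod (\<Sum>k\<in>A. a k * e_unit (real (\<nu> k) * \<theta>)))\<^sup>2) =
           (\<Sum>k\<in>A. (cmod (a k))\<^sup>2)"
    by (simp only: set_borel_integral_eq_integral(2) integral_unique[OF parseval_has_integral[OF assms]])
qed

section \<open>Distance from the integers on the minor arcs\<close>

text \<open>Otherwise \<open>d * \<theta>\<close> is within \<open>K / Q\<close> of an integer
  \<open>a\<close>. Reducing \<open>a / d\<close> to lowest terms \<open>b / q\<close> gives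
  \<open>q \<le> d \<le> K * Q0\<close> and a distance at most
  \<open>K / (d * Q) \<le> K / (q * Q)\<close>, so \<open>\<theta>\<close> would lie on a major
  arc.\<close>

lemma minor_arc_separation:
  assumes "\<theta> \<in> minor_arcs K Q0 Q" "0 < d" "real d \<le> K * Q0" "1 \<le> K" "0 < Q"
  shows "1 / Q \<le> cmod (1 - e_unit (real d * \<theta>))"
proof (rule ccontr)
  assume neg: "\<not> ?thesis"
  define a where "a = round (real d * \<theta>)"
  define s where "s = real d * \<theta> - of_int a"
  have s: "\<bar>s\<bar> \<le> 1/2"
    using of_int_round_abs_le[of "real d * \<theta>"] by (simp add: s_def a_def abs_minus_commute)
  have "e_unit (real d * \<theta>) = e_unit s * e_unit (of_int a)"
    unfolding s_def e_unit_add[symmetric] by simp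
  then have "3 * \<bar>s\<bar> < 1 / Q"
    using norm_one_minus_e_unit[OF s] neg by simp
  then have "\<bar>s\<bar> \<le> K / Q"
    using assms(4,5) by (simp add: field_simps)
  \<comment> \<open>The major arcs ask for a reduced fraction, hence the division of
    \<open>a\<close> and \<open>d\<close> by their gcd.\<close>
  define g where "g = gcd a (int d)"
  have g: "g > 0" using assms(2) by (simp add: g_def)
  define b where "b = a div g"
  define q where "q = nat (int d div g)"
  have bg: "a = b * g" by (simp add: b_def g_def)
  have "int d = (int d div g) * g" by (simp add: g_def)
  moreover have dg0: "int d div g > 0"
    using assms(2) g by (simp add: g_def pos_imp_zdiv_pos_iff zdvd_imp_le)
  ultimately have qg: "int d = int q * g" by (simp add: q_def)
  have q: "q > 0" using dg0 by (simp add: q_def)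
  have cop: "coprime b (int q)"
    using div_gcd_coprime[of a "int d"] assms(2) dg0 by (simp add: b_def q_def g_def)
  have gr: "real_of_int g \<ge> 1" using g by linarith
  have dr: "real d = real q * real_of_int g"
    using qg by (metis of_int_mult of_int_of_nat_eq)
  have qd: "real q \<le> real d" using mult_left_mono[OF gr, of "real q"] by (simp add: dr)
  have "real_of_int a / real d = real_of_int b / real q"
    using g q by (simp add: dr bg)
  then have "\<theta> - real_of_int b / real q = s / real d"
    using assms(2) by (simp add: s_def diff_divide_distrib)
  then have "\<bar>\<theta> - real_of_int b / real q\<bar> = \<bar>s\<bar> / real d"
    by (simp add: abs_divide)
  also have "\<dots> \<le> K / Q / real d"
    using \<open>\<bar>s\<bar> \<le> K / Q\<close> by (rule divide_right_mono) simp
  also have "\<dots> \<le> K / (real q * Q)"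
  proof -
    have "K / Q / real d \<le> K / Q / real q"
      using qd q assms by (intro divide_left_mono) auto
    then show ?thesis by (simp add: mult.commute)
  qed
  finally have "\<theta> \<in> major_arcs K Q0 Q"
    using assms(1,3) q qd cop unfolding major_arcs_def minor_arcs_def
    by (intro CollectI conjI exI[of _ q] exI[of _ b]) auto
  then show False using assms(1) by (simp add: minor_arcs_def)
qed

text \<open>
  The right-hand side is a trigonometric polynomial in disguise, so its mean square is given by
  Parseval's identity.
\<close>

lemma norm_geometric_sum_le:
  fixes z :: complex
  assumes z: "cmod z = 1" "\<eta> \<le> cmod (1 - z)" and \<eta>: "0 < \<eta>" "\<eta> \<le> 1" and n: "(1 - \<eta>) ^ n \<le> 1/2"
  shows "cmod (\<Sum>m=1..M. z ^ m) \<le> 8 * cmod (\<Sum>k<n. of_real ((1 - \<eta>) ^ k) * z ^ k)"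
proof -
  define w where "w = of_real (1 - \<eta>) * z"
  have z1: "z \<noteq> 1" using assms by auto
  have nz: "cmod (1 - z) > 0" using z1 by simp
  have nw: "cmod w = 1 - \<eta>" using z \<eta> by (simp only: w_def norm_mult norm_of_real) simp
  have w1: "w \<noteq> 1" using nw \<eta> by auto
  have pos: "cmod (1 - w) > 0" using w1 by simp
  have "(\<Sum>m=1..M. z ^ m) = z * (\<Sum>m<M. z ^ m)"
    by (simp add: sum_distrib_left sum.atLeast1_atMost_eq)
  also have "\<dots> = z * ((1 - z ^ M) / (1 - z))"
    using z1 by (simp add: sum_gp_strict)
  finally have "cmod (\<Sum>m=1..M. z ^ m) = cmod (1 - z ^ M) / cmod (1 - z)"
    using z by (simp add: norm_mult norm_divide)
  moreover have "cmod (1 - z ^ M) \<le> 2"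
    using norm_triangle_ineq4[of 1 "z ^ M"] z by (simp add: norm_power)
  ultimately have 1: "cmod (\<Sum>m=1..M. z ^ m) \<le> 2 / cmod (1 - z)"
    by (simp add: divide_right_mono)
  \<comment> \<open>Damping \<open>z\<close> by the factor \<open>1 - \<eta>\<close> moves it by
    \<open>\<eta>\<close>, which is at most its distance from 1; so \<open>cmod (1 - w)\<close> is
    at most twice \<open>cmod (1 - z)\<close>.\<close>
  have "1 - w = (1 - z) + of_real \<eta> * z" by (simp add: w_def algebra_simps)
  then have "cmod (1 - w) \<le> cmod (1 - z) + cmod (of_real \<eta> * z)"
    by (metis norm_triangle_ineq)
  then have "cmod (1 - w) \<le> cmod (1 - z) + \<eta>"
    using z \<eta> by (simp add: norm_mult)
  then have "cmod (1 - w) \<le> 2 * cmod (1 - z)" using z by linarith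
  then have 2: "2 / cmod (1 - z) \<le> 4 / cmod (1 - w)"
    using nz pos by (simp add: field_simps)
  have "(\<Sum>k<n. of_real ((1 - \<eta>) ^ k) * z ^ k) = (\<Sum>k<n. w ^ k)"
    by (simp add: w_def power_mult_distrib)
  also have "\<dots> = (1 - w ^ n) / (1 - w)" using w1 by (simp add: sum_gp_strict)
  finally have eq: "cmod (\<Sum>k<n. of_real ((1 - \<eta>) ^ k) * z ^ k) = cmod (1 - w ^ n) / cmod (1 - w)"
    by (simp add: norm_divide)
  \<comment> \<open>The length \<open>n\<close> makes the truncated tail at most 1/2, so the damped
    sum is at least half of \<open>1 / cmod (1 - w)\<close>. The constant 8 collects three factors
    of 2.\<close>
  have "1/2 \<le> cmod (1 - w ^ n)"
    using norm_triangle_ineq2[of 1 "w ^ n"] n by (simp add: norm_power nw)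
  then have "4 / cmod (1 - w) \<le> 8 * (cmod (1 - w ^ n) / cmod (1 - w))"
    using pos by (simp add: field_simps)
  then show ?thesis using 1 2 eq by linarith
qed

section \<open>Mean squares on the minor arcs from short divisor sums\<close>

lemma real_bounded_index_set: "{n. 1 \<le> n \<and> real n \<le> N} = {1..nat \<lfloor>N\<rfloor>}"
proof -
  have "real n \<le> N \<longleftrightarrow> n \<le> nat \<lfloor>N\<rfloor>" if "1 \<le> n" for n
  proof
    assume "n \<le> nat \<lfloor>N\<rfloor>"
    then have "int n \<le> \<lfloor>N\<rfloor>" using that by linarith
    then show "real n \<le> N" by linarith
  qed (rule le_nat_floor)
  then show ?thesis by auto
qed

lemma sum_multiples:
  fixes F :: "nat \<Rightarrow> 'a::comm_monoid_add"
  assumes "0 < d"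
  shows "(\<Sum>n | n \<in> {1..M} \<and> d dvd n. F n) = (\<Sum>m=1..M div d. F (d * m))"
proof (rule sum.reindex_bij_witness[where i = "\<lambda>m. d * m" and j = "\<lambda>n. n div d"])
  fix m assume m: "m \<in> {1..M div d}"
  then have "d * m \<le> M"
    using assms by (simp add: less_eq_div_iff_mult_less_eq mult.commute)
  then show "d * m \<in> {n. n \<in> {1..M} \<and> d dvd n}"
    using assms m by auto
next
  fix n assume "n \<in> {n. n \<in> {1..M} \<and> d dvd n}"
  then show "n div d \<in> {1..M div d}"
    using assms by (auto simp: div_le_mono div_greater_zero_iff Suc_le_eq dvd_imp_le)
qed (use assms in auto)

lemma e_unit_power: "e_unit (real a * \<theta>) ^ k = e_unit (real (a * k) * \<theta>)"
  using e_unit_nat_mult[of k "real a * \<theta>"] by (simp add: mult.assoc mult.left_commute)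

text \<open>Cauchy-Schwarz with each weight split into two factors
  \<open>sqrt \<bar>g i\<bar>\<close>.\<close>

lemma weighted_sum_squared_le:
  fixes g G :: "'i \<Rightarrow> real"
  shows "(\<Sum>i\<in>I. \<bar>g i\<bar> * G i)\<^sup>2 \<le> (\<Sum>i\<in>I. \<bar>g i\<bar>) * (\<Sum>i\<in>I. \<bar>g i\<bar> * (G i)\<^sup>2)"
proof -
  have 1: "sqrt \<bar>g i\<bar> * (sqrt \<bar>g i\<bar> * G i) = \<bar>g i\<bar> * G i" for i
    by (simp flip: mult.assoc)
  have "(\<Sum>i\<in>I. \<bar>g i\<bar> * G i)\<^sup>2 = (\<Sum>i\<in>I. sqrt \<bar>g i\<bar> * (sqrt \<bar>g i\<bar> * G i))\<^sup>2"
    unfolding 1 ..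
  also have "\<dots> \<le> (\<Sum>i\<in>I. (sqrt \<bar>g i\<bar>)\<^sup>2) * (\<Sum>i\<in>I. (sqrt \<bar>g i\<bar> * G i)\<^sup>2)"
    by (rule Cauchy_Schwarz_ineq_sum)
  finally show ?thesis by (simp add: power_mult_distrib)
qed

lemma set_integral_sum:
  fixes F :: "'i \<Rightarrow> 'a \<Rightarrow> real"
  assumes "\<And>i. i \<in> I \<Longrightarrow> set_integrable M A (F i)"
  shows "set_integrable M A (\<lambda>x. \<Sum>i\<in>I. F i x)"
    and "(LINT x:A|M. (\<Sum>i\<in>I. F i x)) = (\<Sum>i\<in>I. LINT x:A|M. F i x)"
  using assms unfolding set_integrable_def set_lebesgue_integral_def scaleR_sum_right
  by (auto intro!: Bochner_Integration.integrable_sum Bochner_Integration.integral_sum)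

text \<open>The common source of all four bounds. On the minor arcs the divisor part is dominated
  pointwise by the damped trigonometric polynomials \<open>G i\<close>; the domain is then enlarged
  to the whole circle, where Parseval applies to each \<open>G i\<close> and to the remainder. The
  index type is arbitrary so that divisors may be indexed by sets of primes.\<close>

lemma minor_integral_le:
  fixes g :: "'i \<Rightarrow> real" and h :: "nat \<Rightarrow> real" and d :: "'i \<Rightarrow> nat"
  assumes I: "finite I" "\<And>i. i \<in> I \<Longrightarrow> 0 < d i \<and> real (d i) \<le> K * Q0"
    and KQ: "1 \<le> K" "1 \<le> Q"
    and f: "\<And>n. 1 \<le> n \<Longrightarrow> real n \<le> N \<Longrightarrow>
              f n = complex_of_real ((\<Sum>i | i \<in> I \<and> d i dvd n. g i) + h n)"
  shows "minor_integral f N K Q0 Q \<le>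
           128 * Q * (\<Sum>i\<in>I. \<bar>g i\<bar>)\<^sup>2 + 2 * (\<Sum>n=1..nat \<lfloor>N\<rfloor>. (h n)\<^sup>2)"
proof -
  define \<eta> where "\<eta> = 1 / Q"
  have \<eta>: "0 < \<eta>" "\<eta> \<le> 1" using KQ by (simp_all add: \<eta>_def)
  \<comment> \<open>\<open>n0\<close> is the truncation length of the damped geometric series; the
    bound \<open>Q\<close> for its mean square does not depend on it.\<close>
  obtain n0 where n0: "(1 - \<eta>) ^ n0 < 1/2"
    using real_arch_pow_inv[of "1/2" "1 - \<eta>"] \<eta> by auto
  define M where "M = nat \<lfloor>N\<rfloor>"
  define W where "W = (\<Sum>i\<in>I. \<bar>g i\<bar>)"
  define G where "G = (\<lambda>i \<theta>. cmod (\<Sum>k<n0. complex_of_real ((1 - \<eta>) ^ k) * e_unit (real (d i * k) * \<theta>)))"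
  define H where "H = (\<lambda>\<theta>. cmod (\<Sum>n\<in>{1..M}. complex_of_real (h n) * e_unit (real n * \<theta>)))"
  define F where "F = (\<lambda>\<theta>. 128 * W * (\<Sum>i\<in>I. \<bar>g i\<bar> * (G i \<theta>)\<^sup>2) + 2 * (H \<theta>)\<^sup>2)"
  have W0: "W \<ge> 0" by (simp add: W_def sum_nonneg)
  have F0: "F \<theta> \<ge> 0" for \<theta>
    unfolding F_def using W0 by (intro add_nonneg_nonneg mult_nonneg_nonneg sum_nonneg) auto
  have Gint: "set_integrable lborel {0..1} (\<lambda>\<theta>. (G i \<theta>)\<^sup>2)"
    and Gle: "(LINT \<theta>:{0..1}|lborel. (G i \<theta>)\<^sup>2) \<le> Q" if i: "i \<in> I" for i
  proof -
    have inj: "inj_on (\<lambda>k. d i * k) {..<n0}" using I(2)[OF i] by (auto intro: inj_onI)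
    show "set_integrable lborel {0..1} (\<lambda>\<theta>. (G i \<theta>)\<^sup>2)"
      unfolding G_def by (rule parseval(1)[OF _ inj]) simp
    have "(LINT \<theta>:{0..1}|lborel. (G i \<theta>)\<^sup>2) = (\<Sum>k<n0. (cmod (complex_of_real ((1 - \<eta>) ^ k)))\<^sup>2)"
      unfolding G_def by (rule parseval(2)[OF _ inj]) simp
    \<comment> \<open>The coefficients lie in [0, 1], so their squares are at most themselves, and
      the geometric series sums to at most \<open>1 / \<eta> = Q\<close>.\<close>
    also have "\<dots> \<le> (\<Sum>k<n0. (1 - \<eta>) ^ k)"
    proof (rule sum_mono)
      fix k
      have "(1 - \<eta>) ^ k \<le> 1" "(1 - \<eta>) ^ k \<ge> 0" using \<eta> by (simp_all add: power_le_one)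
      then have "((1 - \<eta>) ^ k)\<^sup>2 \<le> (1 - \<eta>) ^ k"
        by (simp add: power2_eq_square mult_left_le)
      then show "(cmod (complex_of_real ((1 - \<eta>) ^ k)))\<^sup>2 \<le> (1 - \<eta>) ^ k"
        by (simp only: norm_of_real power2_abs)
    qed
    also have "\<dots> = (1 - (1 - \<eta>) ^ n0) / \<eta>"
      using \<eta> by (simp add: sum_gp_strict)
    also have "\<dots> \<le> 1 / \<eta>"
      using \<eta> by (intro divide_right_mono) auto
    finally show "(LINT \<theta>:{0..1}|lborel. (G i \<theta>)\<^sup>2) \<le> Q"
      by (simp add: \<eta>_def)
  qed
  have Hint: "set_integrable lborel {0..1} (\<lambda>\<theta>. (H \<theta>)\<^sup>2)"
    unfolding H_def using parseval(1)[of "{1..M}" "\<lambda>n. n"] by simp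
  have Heq: "(LINT \<theta>:{0..1}|lborel. (H \<theta>)\<^sup>2) = (\<Sum>n=1..M. (h n)\<^sup>2)"
    unfolding H_def using parseval(2)[of "{1..M}" "\<lambda>n. n" "\<lambda>n. complex_of_real (h n)"] by simp

  have pointwise: "(cmod (exp_sum f N \<theta>))\<^sup>2 \<le> F \<theta>" if \<theta>: "\<theta> \<in> minor_arcs K Q0 Q" for \<theta>
  proof -
    have "exp_sum f N \<theta> = (\<Sum>n=1..M. f n * e_unit (real n * \<theta>))"
      unfolding exp_sum_def M_def real_bounded_index_set ..
    also have "\<dots> = (\<Sum>n=1..M. (\<Sum>i\<in>I. if d i dvd n then of_real (g i) * e_unit (real n * \<theta>) else 0)
                      + of_real (h n) * e_unit (real n * \<theta>))"
    proof (intro sum.cong refl)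
      fix n assume "n \<in> {1..M}"
      then have "n \<in> {n. 1 \<le> n \<and> real n \<le> N}" by (simp only: real_bounded_index_set M_def)
      then have "1 \<le> n" "real n \<le> N" by simp_all
      then have "f n = (\<Sum>i\<in>I. if d i dvd n then of_real (g i) else 0) + of_real (h n)"
        using I(1) by (subst f) (simp_all add: sum.inter_filter if_distrib[of of_real] cong: if_cong)
      then show "f n * e_unit (real n * \<theta>) = (\<Sum>i\<in>I. if d i dvd n then of_real (g i) * e_unit (real n * \<theta>) else 0)
                      + of_real (h n) * e_unit (real n * \<theta>)"
        by (auto simp: ring_distribs sum_distrib_right intro!: sum.cong)
    qed
    \<comment> \<open>After the interchange each index \<open>i\<close> contributes a geometric sum
      over the multiples of \<open>d i\<close>.\<close>
    also have "\<dots> = (\<Sum>i\<in>I. \<Sum>n=1..M. if d i dvd n then of_real (g i) * e_unit (real n * \<theta>) else 0)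
                     + (\<Sum>n=1..M. of_real (h n) * e_unit (real n * \<theta>))"
      by (subst sum.swap) (rule sum.distrib)
    also have "(\<Sum>i\<in>I. \<Sum>n=1..M. if d i dvd n then of_real (g i) * e_unit (real n * \<theta>) else 0) =
               (\<Sum>i\<in>I. of_real (g i) * (\<Sum>m=1..M div d i. e_unit (real (d i) * \<theta>) ^ m))"
    proof (intro sum.cong refl)
      fix i assume i: "i \<in> I"
      have "(\<Sum>n=1..M. if d i dvd n then of_real (g i) * e_unit (real n * \<theta>) else 0) =
            (\<Sum>n | n \<in> {1..M} \<and> d i dvd n. of_real (g i) * e_unit (real n * \<theta>))"
        by (simp only: sum.inter_filter[OF finite_atLeastAtMost])
      also have "\<dots> = (\<Sum>m=1..M div d i. of_real (g i) * e_unit (real (d i * m) * \<theta>))"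
        using I(2)[OF i] by (intro sum_multiples) auto
      also have "\<dots> = (\<Sum>m=1..M div d i. of_real (g i) * e_unit (real (d i) * \<theta>) ^ m)"
        by (simp only: e_unit_power)
      finally show "(\<Sum>n=1..M. if d i dvd n then of_real (g i) * e_unit (real n * \<theta>) else 0) =
        of_real (g i) * (\<Sum>m=1..M div d i. e_unit (real (d i) * \<theta>) ^ m)"
        by (simp add: sum_distrib_left)
    qed
    finally have "exp_sum f N \<theta> =
      (\<Sum>i\<in>I. of_real (g i) * (\<Sum>m=1..M div d i. e_unit (real (d i) * \<theta>) ^ m))
        + (\<Sum>n=1..M. of_real (h n) * e_unit (real n * \<theta>))" .
    then have "cmod (exp_sum f N \<theta>) \<le>
       cmod (\<Sum>i\<in>I. of_real (g i) * (\<Sum>m=1..M div d i. e_unit (real (d i) * \<theta>) ^ m)) + H \<theta>"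
      unfolding H_def by (simp only: norm_triangle_ineq)
    moreover have "cmod (\<Sum>i\<in>I. of_real (g i) * (\<Sum>m=1..M div d i. e_unit (real (d i) * \<theta>) ^ m))
        \<le> (\<Sum>i\<in>I. \<bar>g i\<bar> * (8 * G i \<theta>))"
    proof (rule sum_norm_le)
      fix i assume i: "i \<in> I"
      have "cmod (\<Sum>m=1..M div d i. e_unit (real (d i) * \<theta>) ^ m) \<le>
            8 * cmod (\<Sum>k<n0. of_real ((1 - \<eta>) ^ k) * e_unit (real (d i) * \<theta>) ^ k)"
        using minor_arc_separation[OF \<theta>, of "d i"] I(2)[OF i] KQ \<eta> n0
        by (intro norm_geometric_sum_le) (auto simp: \<eta>_def)
      also have "(\<Sum>k<n0. of_real ((1 - \<eta>) ^ k) * e_unit (real (d i) * \<theta>) ^ k) =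
            (\<Sum>k<n0. complex_of_real ((1 - \<eta>) ^ k) * e_unit (real (d i * k) * \<theta>))"
        by (simp only: e_unit_power)
      finally have "cmod (\<Sum>m=1..M div d i. e_unit (real (d i) * \<theta>) ^ m) \<le> 8 * G i \<theta>"
        by (simp add: G_def)
      then show "cmod (of_real (g i) * (\<Sum>m=1..M div d i. e_unit (real (d i) * \<theta>) ^ m)) \<le> \<bar>g i\<bar> * (8 * G i \<theta>)"
        unfolding norm_mult norm_of_real by (rule mult_left_mono) simp
    qed
    moreover have "(\<Sum>i\<in>I. \<bar>g i\<bar> * (8 * G i \<theta>)) = 8 * (\<Sum>i\<in>I. \<bar>g i\<bar> * G i \<theta>)"
      by (simp add: sum_distrib_left mult_ac)
    ultimately have "cmod (exp_sum f N \<theta>) \<le> 8 * (\<Sum>i\<in>I. \<bar>g i\<bar> * G i \<theta>) + H \<theta>"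
      by linarith
    then have "(cmod (exp_sum f N \<theta>))\<^sup>2 \<le> (8 * (\<Sum>i\<in>I. \<bar>g i\<bar> * G i \<theta>) + H \<theta>)\<^sup>2"
      by (intro power_mono) auto
    \<comment> \<open>Here 128 is \<open>2 * 8\<^sup>2\<close>, from the square of a sum of two
      terms.\<close>
    also have "\<dots> \<le> 128 * (\<Sum>i\<in>I. \<bar>g i\<bar> * G i \<theta>)\<^sup>2 + 2 * (H \<theta>)\<^sup>2"
      using sum_squares_bound[of "8 * (\<Sum>i\<in>I. \<bar>g i\<bar> * G i \<theta>)" "H \<theta>"]
      by (simp add: power2_sum power_mult_distrib)
    also have "\<dots> \<le> F \<theta>"
      using weighted_sum_squared_le[of g "\<lambda>i. G i \<theta>" I] by (simp add: F_def W_def)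
    finally show ?thesis .
  qed

  have gG: "set_integrable lborel {0..1} (\<lambda>\<theta>. \<bar>g i\<bar> * (G i \<theta>)\<^sup>2)" if "i \<in> I" for i
    using Gint[OF that] by simp
  have int1: "set_integrable lborel {0..1} (\<lambda>\<theta>. 128 * W * (\<Sum>i\<in>I. \<bar>g i\<bar> * (G i \<theta>)\<^sup>2))"
    by (intro set_integrable_mult_right set_integral_sum(1) gG)
  have sumG: "(LINT \<theta>:{0..1}|lborel. (\<Sum>i\<in>I. \<bar>g i\<bar> * (G i \<theta>)\<^sup>2)) =
      (\<Sum>i\<in>I. LINT \<theta>:{0..1}|lborel. \<bar>g i\<bar> * (G i \<theta>)\<^sup>2)"
    by (intro set_integral_sum(2) gG)
  have int2: "set_integrable lborel {0..1} (\<lambda>\<theta>. 2 * (H \<theta>)\<^sup>2)"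
    using Hint by simp
  have Fint: "set_integrable lborel {0..1} F"
    unfolding F_def by (rule set_integral_add(1)[OF int1 int2])
  have "minor_integral f N K Q0 Q \<le> (LINT \<theta>:{0..1}|lborel. F \<theta>)"
    unfolding minor_integral_def set_lebesgue_integral_def
  \<comment> \<open>Integrability is asked of the nonnegative majorant only; a left side that is not
    integrable would have the default integral 0.\<close>
  proof (rule integral_mono')
    show "integrable lborel (\<lambda>x. indicat_real {0..1} x *\<^sub>R F x)"
      using Fint by (simp add: set_integrable_def)
    fix x :: real
    show "indicat_real (minor_arcs K Q0 Q) x *\<^sub>R (cmod (exp_sum f N x))\<^sup>2 \<le> indicat_real {0..1} x *\<^sub>R F x"
    proof (cases "x \<in> minor_arcs K Q0 Q")
      case True
      then have "x \<in> {0..1}" by (auto simp: minor_arcs_def circle_def)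
      with True pointwise show ?thesis by simp
    qed (use F0 in \<open>simp add: indicator_def\<close>)
    show "0 \<le> indicat_real {0..1} x *\<^sub>R F x" using F0 by simp
  qed
  also have "(LINT \<theta>:{0..1}|lborel. F \<theta>) =
      128 * W * (\<Sum>i\<in>I. \<bar>g i\<bar> * (LINT \<theta>:{0..1}|lborel. (G i \<theta>)\<^sup>2)) + 2 * (\<Sum>n=1..M. (h n)\<^sup>2)"
    unfolding F_def by (simp add: set_integral_add(2)[OF int1 int2] sumG Heq)
  finally have 1: "minor_integral f N K Q0 Q \<le>
    128 * W * (\<Sum>i\<in>I. \<bar>g i\<bar> * (LINT \<theta>:{0..1}|lborel. (G i \<theta>)\<^sup>2)) + 2 * (\<Sum>n=1..M. (h n)\<^sup>2)" .
  have "(\<Sum>i\<in>I. \<bar>g i\<bar> * (LINT \<theta>:{0..1}|lborel. (G i \<theta>)\<^sup>2)) \<le> (\<Sum>i\<in>I. \<bar>g i\<bar> * Q)"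
    using Gle by (intro sum_mono mult_left_mono) auto
  also have "\<dots> = W * Q" by (simp add: W_def sum_distrib_right)
  finally have "128 * W * (\<Sum>i\<in>I. \<bar>g i\<bar> * (LINT \<theta>:{0..1}|lborel. (G i \<theta>)\<^sup>2)) \<le> 128 * W * (W * Q)"
    using W0 by (intro mult_left_mono) auto
  with 1 show ?thesis by (simp add: M_def W_def power2_eq_square mult_ac)
qed

section \<open>Reciprocals of primes\<close>

text \<open>Open on the left and closed on the right, so that consecutive ranges join without
  overlap.\<close>

definition primes_in :: "real \<Rightarrow> real \<Rightarrow> nat set" where
  "primes_in y x = {p. prime p \<and> y < real p \<and> real p \<le> x}"

lemma finite_primes_in [simp]: "finite (primes_in y x)"
proof (rule finite_subset)
  show "primes_in y x \<subseteq> {..nat \<lfloor>x\<rfloor>}"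
    by (auto simp: primes_in_def intro: le_nat_floor)
qed simp

lemma primes_in_split:
  assumes "y \<le> z" "z \<le> x"
  shows "primes_in y x = primes_in y z \<union> primes_in z x" "primes_in y z \<inter> primes_in z x = {}"
  using assms by (auto simp: primes_in_def)

definition reciprocal_sum :: "real \<Rightarrow> real \<Rightarrow> real" where
  "reciprocal_sum y x = (\<Sum>p\<in>primes_in y x. 1 / real p)"

lemma reciprocal_sum_nonneg [simp]: "0 \<le> reciprocal_sum y x"
  by (simp add: reciprocal_sum_def sum_nonneg)

lemma reciprocal_sum_mono:
  assumes "y' \<le> y" "x \<le> x'"
  shows "reciprocal_sum y x \<le> reciprocal_sum y' x'"
  unfolding reciprocal_sum_def
  by (intro sum_mono2 finite_primes_in) (use assms in \<open>auto simp: primes_in_def\<close>)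

lemma reciprocal_sum_split:
  assumes "y \<le> z" "z \<le> x"
  shows "reciprocal_sum y x = reciprocal_sum y z + reciprocal_sum z x"
  unfolding reciprocal_sum_def primes_in_split(1)[OF assms]
  using primes_in_split(2)[OF assms] by (intro sum.union_disjoint) auto

section \<open>Chebyshev's bound and dyadic blocks\<close>

lemma prod_primes_dvd:
  fixes n :: nat
  assumes "finite A" "\<And>p. p \<in> A \<Longrightarrow> prime p \<and> p dvd n"
  shows "\<Prod>A dvd n"
  using assms
proof (induction A rule: finite_induct)
  case (insert p A)
  have "coprime p (\<Prod>A)"
    using insert by (intro prod_coprime_right) (metis insertCI primes_coprime)
  then show ?case using insert by (simp add: divides_mult)
qed simp

text \<open>Chebyshev: the primes in \<open>(n, 2n + 1]\<close> all divide \<open>(2n + 1) (2n choose n)\<close>.\<close>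

lemma reciprocal_sum_double:
  assumes t: "1 < t"
  shows "reciprocal_sum t (2 * t) \<le> 4 / ln t"
proof -
  define n where "n = nat \<lfloor>t\<rfloor>"
  define A where "A = primes_in t (2 * t)"
  have n: "real n \<le> t" "t < real n + 1" "1 \<le> n"
    using t by (simp_all add: n_def le_nat_iff le_floor_iff)
  have A: "prime p \<and> n < p \<and> p \<le> 2 * n + 1" if "p \<in> A" for p
  proof -
    have "t < real p" "real p \<le> 2 * t" "prime p" using that by (auto simp: A_def primes_in_def)
    moreover have "real p < 2 * real n + 2" using calculation n by linarith
    then have "p < 2 * n + 2" by linarith
    moreover have "n < p" using calculation n by linarith
    ultimately show ?thesis by simp
  qed
  \<comment> \<open>As \<open>t\<close> is real and \<open>n\<close> its integer part, primes up to
    \<open>2 * t\<close> may reach \<open>2 * n + 1\<close>, which need not divide the binomial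
    coefficient; the extra factor takes care of it.\<close>
  have "p dvd (2 * n + 1) * (2 * n choose n)" if "p \<in> A" for p
  proof (cases "p = 2 * n + 1")
    case False
    then have p: "prime p" "n < p" "p \<le> 2 * n" using A[OF that] by auto
    have "fact n * fact n * (2 * n choose n) = (fact (2 * n) :: nat)"
      using binomial_fact_lemma[of n "2 * n"] by simp
    moreover have "p dvd fact (2 * n)" "\<not> p dvd fact n"
      using p by (simp_all add: prime_dvd_fact_iff)
    ultimately show ?thesis using p(1) by (metis prime_dvd_mult_iff dvd_mult)
  qed (simp only: dvd_triv_left)
  then have "\<Prod>A dvd (2 * n + 1) * (2 * n choose n)"
    using A by (intro prod_primes_dvd) (auto simp: A_def)
  then have "\<Prod>A \<le> (2 * n + 1) * (2 * n choose n)"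
    by (intro dvd_imp_le) auto
  also have "\<dots> \<le> (2 * n + 1) * 2 ^ (2 * n)"
    by (intro mult_left_mono binomial_le_pow2) auto
  finally have "real (\<Prod>A) \<le> real ((2 * n + 1) * 2 ^ (2 * n))"
    by (simp only: of_nat_le_iff)
  moreover have "0 < \<Prod>A" using A by (intro prod_pos) (auto simp: prime_gt_0_nat)
  ultimately have "ln (real (\<Prod>A)) \<le> ln (real ((2 * n + 1) * 2 ^ (2 * n)))"
    by (intro ln_mono) (simp_all only: of_nat_0_less_iff)
  also have "\<dots> = ln (1 + 2 * real n) + 2 * real n * ln 2"
    by (simp only: of_nat_mult of_nat_power, subst ln_mult_pos) (simp_all add: ln_realpow add.commute)
  also have "\<dots> \<le> 2 * real n + 2 * real n * 1"
    using ln_le_minus_one[of 2] ln_add_one_self_le_self[of "2 * real n"] by (intro add_mono mult_left_mono) auto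
  finally have L: "ln (real (\<Prod>A)) \<le> 4 * real n" by simp
  \<comment> \<open>Each prime exceeds \<open>t\<close>, so its reciprocal weighted by
    \<open>t * ln t\<close> is at most \<open>ln p\<close>, and the logarithms add up to that of the
    product.\<close>
  have "reciprocal_sum t (2 * t) * (t * ln t) = (\<Sum>p\<in>A. t * ln t / real p)"
    by (simp add: reciprocal_sum_def A_def sum_distrib_right)
  also have "\<dots> \<le> (\<Sum>p\<in>A. ln (real p))"
  proof (rule sum_mono)
    fix p assume "p \<in> A"
    then have p: "t < real p" by (auto simp: A_def primes_in_def)
    then have "t * ln t \<le> real p * ln (real p)" using t by (intro mult_mono) auto
    then show "t * ln t / real p \<le> ln (real p)" using p t by (simp add: field_simps)
  qed
  also have "\<dots> = ln (real (\<Prod>A))"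
    using A by (subst of_nat_prod, subst ln_prod) (auto simp: A_def prime_gt_0_nat)
  also have "\<dots> \<le> 4 * t" using L n by linarith
  finally have "reciprocal_sum t (2 * t) * ln t \<le> 4"
    using t by (simp add: mult_ac)
  then show ?thesis using t by (simp add: field_simps)
qed

lemma reciprocal_sum_double_iter:
  assumes "1 < y"
  shows "reciprocal_sum y (2 ^ J * y) \<le> 4 * real J / ln y"
proof (induction J)
  case 0
  have "primes_in y y = {}" by (auto simp: primes_in_def)
  then show ?case by (simp add: reciprocal_sum_def)
next
  case (Suc J)
  have ge: "y \<le> 2 ^ J * y" using assms by simp
  have "reciprocal_sum y (2 ^ Suc J * y) = reciprocal_sum y (2 ^ J * y) + reciprocal_sum (2 ^ J * y) (2 * (2 ^ J * y))"
    using reciprocal_sum_split[OF ge, of "2 * (2 ^ J * y)"] assms by (simp add: mult_ac)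
  also have "reciprocal_sum (2 ^ J * y) (2 * (2 ^ J * y)) \<le> 4 / ln (2 ^ J * y)"
    using less_le_trans[OF assms ge] by (rule reciprocal_sum_double)
  also have "\<dots> \<le> 4 / ln y"
    using ge assms less_le_trans[OF assms ge] by (intro divide_left_mono mult_pos_pos) simp_all
  finally show ?case using Suc by (simp add: add_divide_distrib)
qed

text \<open>Counts dyadic blocks, each contributing at most \<open>4 / ln y\<close>; the
  \<open>+ 1\<close> pays for rounding their number up. This form is effective when \<open>x\<close>
  is not much larger than \<open>y\<close>, as for smooth numbers.\<close>

lemma reciprocal_sum_le_log_ratio:
  assumes "1 < y" "y \<le> x"
  shows "reciprocal_sum y x \<le> 4 * (log 2 (x / y) + 1) / ln y"
proof -
  define J where "J = nat \<lceil>log 2 (x / y)\<rceil>"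
  have l0: "0 \<le> log 2 (x / y)" using assms by simp
  have J: "log 2 (x / y) \<le> real J" "real J \<le> log 2 (x / y) + 1"
    using l0 unfolding J_def by linarith+
  have "x / y = 2 powr log 2 (x / y)" using assms by simp
  also have "\<dots> \<le> 2 powr real J" using J by (intro powr_mono) auto
  finally have "x \<le> 2 ^ J * y" using assms by (simp add: powr_realpow field_simps)
  then have "reciprocal_sum y x \<le> reciprocal_sum y (2 ^ J * y)"
    by (intro reciprocal_sum_mono) auto
  also have "\<dots> \<le> 4 * real J / ln y" by (rule reciprocal_sum_double_iter[OF assms(1)])
  also have "\<dots> \<le> 4 * (log 2 (x / y) + 1) / ln y"
    using J assms by (intro divide_right_mono) auto
  finally show ?thesis .
qed

section \<open>Mertens-type upper bounds with iterated logarithms\<close>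

lemma ln_2_bounds: "2/3 \<le> ln (2::real)" "ln (2::real) \<le> 25/36"
  using ln2_ge_two_thirds ln2_le_25_over_36 by simp_all

text \<open>Between \<open>y\<close> and its square the dyadic bound is constant:
  \<open>4 / ln 2 \<le> 6\<close> and, as \<open>ln y \<ge> 1 / 6\<close>,
  \<open>4 / ln y \<le> 24\<close>. The lower limit \<open>ln 2 / 4\<close> is the least value of
  \<open>ln y\<close> for \<open>y\<close> the fourth root of \<open>2 * N / Q\<close>, since
  \<open>Q \<le> N\<close>.\<close>

lemma reciprocal_sum_square:
  assumes y: "ln 2 / 4 \<le> ln y" "1 < y"
  shows "reciprocal_sum y (y ^ 2) \<le> 30"
proof -
  have l: "ln y \<ge> 1/6" using y ln_2_bounds by simp
  have "y * 1 \<le> y * y" using y by (intro mult_left_mono) auto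
  then have "reciprocal_sum y (y ^ 2) \<le> 4 * (log 2 (y ^ 2 / y) + 1) / ln y"
    using y by (intro reciprocal_sum_le_log_ratio) (auto simp: power2_eq_square)
  also have "y ^ 2 / y = y" using y by (simp add: power2_eq_square)
  also have "4 * (log 2 y + 1) / ln y = 4 / ln 2 + 4 / ln y"
    using l by (simp add: log_def field_simps)
  also have "\<dots> \<le> 6 + 24"
    using l ln_2_bounds by (intro add_mono) (simp_all add: field_simps)
  finally show ?thesis by simp
qed

lemma reciprocal_sum_square_iter:
  assumes y: "ln 2 / 4 \<le> ln y" "1 < y"
  shows "reciprocal_sum y (y ^ (2 ^ J)) \<le> 30 * real J"
proof (induction J)
  case 0
  have "primes_in y y = {}" by (auto simp: primes_in_def)
  then show ?case by (simp add: reciprocal_sum_def)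
next
  case (Suc J)
  have ge: "y \<le> y ^ (2 ^ J)" using y power_increasing[of 1 "2 ^ J" y] by simp
  have ge': "y ^ (2 ^ J) \<le> (y ^ (2 ^ J)) ^ 2"
    using ge y power_increasing[of 1 2 "y ^ (2 ^ J)"] by simp
  have "reciprocal_sum y (y ^ (2 ^ Suc J)) = reciprocal_sum y (y ^ (2 ^ J)) + reciprocal_sum (y ^ (2 ^ J)) ((y ^ (2 ^ J)) ^ 2)"
    using reciprocal_sum_split[OF ge ge'] by (simp add: mult.commute flip: power_mult)
  also have "reciprocal_sum (y ^ (2 ^ J)) ((y ^ (2 ^ J)) ^ 2) \<le> 30"
  proof (rule reciprocal_sum_square)
    have "ln y \<le> ln (y ^ (2 ^ J))" using ge y by simp
    then show "ln 2 / 4 \<le> ln (y ^ (2 ^ J))" using y by linarith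
  qed (use ge y in linarith)
  finally show ?case using Suc by simp
qed

text \<open>Repeated squaring doubles the logarithm, so the number of blocks is the binary logarithm
  of \<open>ln x / ln y\<close>, rounded up.\<close>

lemma reciprocal_sum_le_log_log_ratio:
  assumes y: "ln 2 / 4 \<le> ln y" "1 < y" and x: "y \<le> x"
  shows "reciprocal_sum y x \<le> 30 * (log 2 (ln x / ln y) + 1)"
proof -
  define J where "J = nat \<lceil>log 2 (ln x / ln y)\<rceil>"
  have lny: "ln y > 0" "ln x > 0" "ln y \<le> ln x" using y x by auto
  then have l0: "0 \<le> log 2 (ln x / ln y)" by simp
  have J: "log 2 (ln x / ln y) \<le> real J" "real J \<le> log 2 (ln x / ln y) + 1"
    using l0 unfolding J_def by linarith+
  have "ln x / ln y = 2 powr log 2 (ln x / ln y)" using lny by simp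
  also have "\<dots> \<le> 2 powr real J" using J by (intro powr_mono) auto
  finally have "ln x \<le> ln (y ^ (2 ^ J))" using lny y by (simp add: powr_realpow field_simps ln_realpow)
  then have "x \<le> y ^ (2 ^ J)" using y x by simp
  then have "reciprocal_sum y x \<le> reciprocal_sum y (y ^ (2 ^ J))"
    by (intro reciprocal_sum_mono) auto
  also have "\<dots> \<le> 30 * real J" by (rule reciprocal_sum_square_iter[OF y])
  also have "\<dots> \<le> 30 * (log 2 (ln x / ln y) + 1)" using J by simp
  finally show ?thesis .
qed

lemma reciprocal_sum_le_log_log:
  assumes "exp (exp 8) \<le> x"
  shows "reciprocal_sum y x \<le> 60 * ln (ln x)"
proof -
  \<comment> \<open>The smallest starting point that the previous bound admits; it lies below every
    prime.\<close>
  define z where "z = (2::real) powr (1/4)"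
  have lnz: "ln z = ln 2 / 4" by (simp add: z_def ln_powr)
  have z: "1 < z" "z < 2" using powr_less_mono[of "1/4" 1 "2::real"] by (simp_all add: z_def)
  have xp: "x > 0" using assms exp_gt_zero[of "exp 8 :: real"] by linarith
  have lx: "exp 8 \<le> ln x" using assms xp by (subst ln_ge_iff) auto
  then have lx0: "0 < ln x" using exp_gt_zero[of "8::real"] by linarith
  have llx: "8 \<le> ln (ln x)" using lx lx0 by (subst ln_ge_iff) auto
  have "z \<le> x"
  proof -
    have "2 \<le> exp (1::real)" using exp_ge_add_one_self[of 1] by simp
    also have "\<dots> \<le> exp (exp 8)" using exp_ge_add_one_self[of 8] by simp
    finally show ?thesis using assms z by linarith
  qed
  have "reciprocal_sum y x \<le> reciprocal_sum z x"
    unfolding reciprocal_sum_def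
  proof (intro sum_mono2 finite_primes_in)
    show "primes_in y x \<subseteq> primes_in z x"
    proof
      fix p assume "p \<in> primes_in y x"
      moreover from this have "2 \<le> p" by (auto simp: primes_in_def prime_ge_2_nat)
      then have "z < real p" using z by linarith
      ultimately show "p \<in> primes_in z x" by (simp add: primes_in_def)
    qed
  qed auto
  also have "\<dots> \<le> 30 * (log 2 (ln x / ln z) + 1)"
    using z lnz \<open>z \<le> x\<close> by (intro reciprocal_sum_le_log_log_ratio) auto
  also have "log 2 (ln x / ln z) = (ln (ln x) - ln (ln 2 / 4)) / ln 2"
    using lx0 ln_div[of "ln x" "ln 2 / 4"] by (simp only: log_def lnz) simp
  also have "\<dots> \<le> (ln (ln x) + 2) / ln 2"
  proof -
    have "5/2 \<le> exp (1::real)"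
      using exp_lower_Taylor_quadratic[of 1] by simp
    then have "(5/2)\<^sup>2 \<le> (exp (1::real))\<^sup>2" by (intro power_mono) auto
    also have "\<dots> = exp 2" by (simp flip: exp_of_nat_mult)
    finally have "6 \<le> exp (2::real)" by (simp add: power2_eq_square)
    then have "1 \<le> exp 2 * (ln 2 / 4 :: real)"
      using ln_2_bounds mult_mono[of 6 "exp 2" "1/6" "ln 2 / 4 :: real"] by simp
    then have "exp (- 2) \<le> ln 2 / (4 :: real)" by (simp add: exp_minus field_simps)
    then have "- 2 \<le> ln (ln 2 / 4 :: real)" by (subst ln_ge_iff) auto
    then show ?thesis by (intro divide_right_mono) auto
  qed
  also have "\<dots> \<le> (ln (ln x) + 2) * (3 / 2)"
    using llx ln_2_bounds mult_left_mono[of "2/3" "ln 2" "ln (ln x) + 2"] by (simp add: field_simps)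
  finally have "reciprocal_sum y x \<le> 30 * ((ln (ln x) + 2) * (3 / 2) + 1)"
    by simp
  \<comment> \<open>The left side is \<open>45 * ln (ln x) + 120\<close>, so 60 suffices exactly
    from \<open>ln (ln x) = 8\<close> on; this fixes the threshold
    \<open>exp (exp 8)\<close>.\<close>
  also have "\<dots> \<le> 60 * ln (ln x)" using llx by (simp add: field_simps)
  finally show ?thesis .
qed

section \<open>Moments of the number of prime factors\<close>

text \<open>An upper bound for the mean of a multiplicative weight by an Euler product. Write
  \<open>\<phi>\<close> as 1 plus nonnegative increments attached to the conditions
  \<open>p ^ k dvd n\<close>, drop the floor in \<open>M div p ^ k\<close>, and remove the primes
  one at a time. The induction runs over all \<open>M\<close> because dividing by
  \<open>p ^ k\<close> shortens the range.\<close>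

lemma sum_product_multiplicity_le:
  fixes \<phi> :: "nat \<Rightarrow> real" and E :: "nat \<Rightarrow> real"
  assumes "finite P" and P: "\<And>p. p \<in> P \<Longrightarrow> prime p"
    and \<phi>: "\<phi> 0 = 1" "mono \<phi>"
    and E: "\<And>p J. p \<in> P \<Longrightarrow> 1 + (\<Sum>k=1..J. (\<phi> k - \<phi> (k - 1)) / real p ^ k) \<le> E p"
  shows "(\<Sum>n=1..M. \<Prod>p\<in>P. \<phi> (multiplicity p n)) \<le> real M * (\<Prod>p\<in>P. E p)"
  using assms(1) P E
proof (induction P arbitrary: M rule: finite_induct)
  case empty
  show ?case by simp
next
  case (insert p P)
  define h where "h = (\<lambda>n. \<Prod>q\<in>P. \<phi> (multiplicity q n))"
  define \<Delta> where "\<Delta> = (\<lambda>k. \<phi> k - \<phi> (k - 1))"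
  have \<Delta>: "\<Delta> k \<ge> 0" for k using monoD[OF \<phi>(2), of "k - 1" k] by (simp add: \<Delta>_def)
  have \<phi>1: "\<phi> k \<ge> 1" for k using monoD[OF \<phi>(2), of 0 k] \<phi>(1) by simp
  have E1: "E q \<ge> 1" if "q \<in> insert p P" for q using insert.prems(2)[OF that, of 0] by simp
  have IH: "(\<Sum>n=1..M. h n) \<le> real M * (\<Prod>q\<in>P. E q)" for M
    unfolding h_def by (rule insert.IH) (use insert.prems in auto)
  have p: "prime p" using insert.prems by simp
  then have p2: "p \<ge> 2" by (rule prime_ge_2_nat)
  have C0: "(\<Prod>q\<in>P. E q) \<ge> 0" using order_trans[OF zero_le_one E1] by (intro prod_nonneg) simp
  have tel: "\<phi> v = 1 + (\<Sum>k=1..v. \<Delta> k)" for v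
    by (induction v) (simp_all add: \<phi>(1) \<Delta>_def)
  \<comment> \<open>Stopping at \<open>k = M\<close> loses nothing, since the multiplicity is less
    than \<open>p ^ multiplicity p n\<close>, hence less than \<open>n\<close>'s upper limit
    \<open>M\<close>.\<close>
  have expand: "\<phi> (multiplicity p n) = 1 + (\<Sum>k=1..M. if p ^ k dvd n then \<Delta> k else 0)"
    if n: "n \<in> {1..M}" for n
  proof -
    have "multiplicity p n \<le> M"
    proof -
      have "p ^ multiplicity p n \<le> n"
        using n by (intro dvd_imp_le multiplicity_dvd) auto
      moreover have "multiplicity p n < p ^ multiplicity p n"
        using p2 by (intro power_gt_expt) auto
      ultimately show ?thesis using n by simp
    qed
    then have "{k \<in> {1..M}. k \<le> multiplicity p n} = {1..multiplicity p n}" by auto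
    moreover have dvd_iff: "p ^ k dvd n \<longleftrightarrow> k \<le> multiplicity p n" for k
      using n p p2 by (intro power_dvd_iff_le_multiplicity) auto
    ultimately have "{k \<in> {1..M}. p ^ k dvd n} = {1..multiplicity p n}" by (simp only: dvd_iff)
    then show ?thesis
      unfolding tel[of "multiplicity p n"] by (simp flip: sum.inter_filter)
  qed
  have "(\<Sum>n=1..M. \<Prod>q\<in>insert p P. \<phi> (multiplicity q n)) = (\<Sum>n=1..M. \<phi> (multiplicity p n) * h n)"
    using insert.hyps by (simp add: h_def)
  also have "\<dots> = (\<Sum>n=1..M. h n + (\<Sum>k=1..M. if p ^ k dvd n then \<Delta> k * h n else 0))"
    by (intro sum.cong refl)
       (simp add: expand ring_distribs sum_distrib_right if_distrib[of "\<lambda>x. x * _"] cong: if_cong)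
  also have "\<dots> = (\<Sum>n=1..M. h n) + (\<Sum>k=1..M. \<Sum>n=1..M. if p ^ k dvd n then \<Delta> k * h n else 0)"
    by (subst sum.swap) (rule sum.distrib)
  also have "(\<Sum>k=1..M. \<Sum>n=1..M. if p ^ k dvd n then \<Delta> k * h n else 0) \<le>
             (\<Sum>k=1..M. \<Delta> k * (real M / real p ^ k * (\<Prod>q\<in>P. E q)))"
  proof (rule sum_mono)
    fix k
    have hp: "h (p ^ k * m) = h m" if "m \<in> {1..M div p ^ k}" for m
      unfolding h_def
    proof (intro prod.cong refl arg_cong[of _ _ \<phi>])
      fix q assume q: "q \<in> P"
      then have "prime q" "q \<noteq> p" using insert by auto
      then have "multiplicity q (p ^ k) = 0"
        using p by (simp add: prime_multiplicity_other prime_elem_multiplicity_power_distrib multiplicity_distinct_prime_power)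
      then show "multiplicity q (p ^ k * m) = multiplicity q m"
        using \<open>prime q\<close> that p2 by (subst prime_elem_multiplicity_mult_distrib) auto
    qed
    have "(\<Sum>n=1..M. if p ^ k dvd n then \<Delta> k * h n else 0) = (\<Sum>n | n \<in> {1..M} \<and> p ^ k dvd n. \<Delta> k * h n)"
      by (simp only: sum.inter_filter[OF finite_atLeastAtMost])
    also have "\<dots> = (\<Sum>m=1..M div p ^ k. \<Delta> k * h (p ^ k * m))"
      using p2 by (intro sum_multiples) auto
    also have "\<dots> = \<Delta> k * (\<Sum>m=1..M div p ^ k. h m)"
      unfolding sum_distrib_left by (intro sum.cong refl) (simp add: hp)
    also have "\<dots> \<le> \<Delta> k * (real (M div p ^ k) * (\<Prod>q\<in>P. E q))"
      using IH \<Delta> by (intro mult_left_mono) auto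
    also have "\<dots> \<le> \<Delta> k * (real M / real p ^ k * (\<Prod>q\<in>P. E q))"
      using of_nat_div_le_of_nat[where ?'a = real, of M "p ^ k"] C0 \<Delta> by (intro mult_left_mono mult_right_mono) auto
    finally show "(\<Sum>n=1..M. if p ^ k dvd n then \<Delta> k * h n else 0) \<le>
      \<Delta> k * (real M / real p ^ k * (\<Prod>q\<in>P. E q))" .
  qed
  also have "(\<Sum>n=1..M. h n) \<le> real M * (\<Prod>q\<in>P. E q)" by (rule IH)
  also have "real M * (\<Prod>q\<in>P. E q) + (\<Sum>k=1..M. \<Delta> k * (real M / real p ^ k * (\<Prod>q\<in>P. E q))) =
     (1 + (\<Sum>k=1..M. \<Delta> k / real p ^ k)) * (real M * (\<Prod>q\<in>P. E q))"
    by (simp add: ring_distribs sum_distrib_right sum_distrib_left mult_ac)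
  also have "\<dots> \<le> E p * (real M * (\<Prod>q\<in>P. E q))"
    using insert.prems(2)[of p M] C0 by (intro mult_right_mono) (auto simp: \<Delta>_def)
  finally show ?case using insert.hyps by (simp add: mult_ac)
qed

text \<open>For \<open>k \<ge> 2\<close> the increment is \<open>x * (t - 1) * t ^ (k - 2)\<close>.
  The ratio \<open>t / q\<close> is at most 3/4, so the geometric series is at most 4.\<close>

lemma euler_factor_le:
  fixes x t q :: real
  defines "\<phi> \<equiv> \<lambda>k::nat. if k = 0 then 1 else x * t ^ (k - 1)"
  assumes x: "1 \<le> x" and t: "1 \<le> t" "t \<le> 3/2" and q: "2 \<le> q"
  shows "1 + (\<Sum>k=1..J. (\<phi> k - \<phi> (k - 1)) / q ^ k) \<le> 1 + (x - 1) / q + 4 * x * (t - 1) / q\<^sup>2"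
proof (cases J)
  case 0
  then show ?thesis using x t q by simp
next
  case (Suc i)
  have tq: "0 \<le> t / q" "t / q \<le> 3/4" using t q by (simp_all add: field_simps)
  have "(\<Sum>k=1..Suc i. (\<phi> k - \<phi> (k - 1)) / q ^ k) = (x - 1) / q + x * (t - 1) / q\<^sup>2 * (\<Sum>k<i. (t / q) ^ k)"
  proof (induction i)
    case 0
    show ?case by (simp add: \<phi>_def)
  next
    case (Suc i)
    have "(\<phi> (Suc (Suc i)) - \<phi> (Suc (Suc i) - 1)) / q ^ Suc (Suc i) = x * (t - 1) / q\<^sup>2 * (t / q) ^ i"
      using q by (simp add: \<phi>_def power2_eq_square power_divide field_simps)
    then show ?case using Suc.IH by (simp add: ring_distribs)
  qed
  moreover have "(\<Sum>k<i. (t / q) ^ k) \<le> (\<Sum>k<i. (3/4) ^ k)"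
    using tq by (intro sum_mono power_mono) auto
  moreover have "(\<Sum>k<i. (3/4::real) ^ k) \<le> 4"
    by (simp add: sum_gp_strict)
  ultimately have "(\<Sum>k=1..Suc i. (\<phi> k - \<phi> (k - 1)) / q ^ k) \<le> (x - 1) / q + x * (t - 1) / q\<^sup>2 * 4"
    using x t mult_left_mono[of "\<Sum>k<i. (t / q) ^ k" 4 "x * (t - 1) / q\<^sup>2"] by simp
  then show ?thesis using Suc by (simp add: mult_ac)
qed

lemma big_omega_eq_sum: "big_omega n = (\<Sum>p\<in>prime_factors n. multiplicity p n)"
  unfolding big_omega_def size_multiset_overloaded_eq
  by (intro sum.cong refl) (simp add: count_prime_factorization_prime in_prime_factors_imp_prime)

lemma little_omega_le_big_omega: "little_omega n \<le> big_omega n"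
proof -
  have "(\<Sum>p\<in>prime_factors n. 1) \<le> (\<Sum>p\<in>prime_factors n. multiplicity p n)"
    by (intro sum_mono) (auto simp: prime_factors_multiplicity)
  then show ?thesis by (simp add: big_omega_eq_sum little_omega_def)
qed

lemma primes_in_1: "primes_in 1 x = {p. prime p \<and> real p \<le> x}"
  by (auto simp: primes_in_def dest: prime_gt_1_nat)

text \<open>A prime contributes \<open>a\<close> to the exponent for its first occurrence in
  \<open>n\<close> and \<open>b\<close> for every repetition.\<close>

lemma exp_omega_eq_prod:
  fixes a b N :: real
  assumes n: "1 \<le> n" "real n \<le> N"
  shows "exp (a * little_omega n + b * (real (big_omega n) - little_omega n)) =
    (\<Prod>p\<in>primes_in 1 N. if multiplicity p n = 0 then 1 else exp a * exp b ^ (multiplicity p n - 1))"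
proof -
  have sub: "prime_factors n \<subseteq> primes_in 1 N"
  proof
    fix p assume "p \<in> prime_factors n"
    then have "prime p" "p \<le> n" using n by (auto intro: dvd_imp_le simp: prime_factors_dvd)
    then show "p \<in> primes_in 1 N" using n by (auto simp: primes_in_1)
  qed
  have "(\<Prod>p\<in>primes_in 1 N. if multiplicity p n = 0 then 1 else exp a * exp b ^ (multiplicity p n - 1)) =
        (\<Prod>p\<in>prime_factors n. if multiplicity p n = 0 then 1 else exp a * exp b ^ (multiplicity p n - 1))"
    using sub n by (intro prod.mono_neutral_right finite_primes_in)
      (auto simp: prime_factors_multiplicity primes_in_1)
  also have "\<dots> = (\<Prod>p\<in>prime_factors n. exp (a + b * (real (multiplicity p n) - 1)))"
  proof (intro prod.cong refl)
    fix p assume "p \<in> prime_factors n"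
    then have "multiplicity p n > 0" by (simp add: prime_factors_multiplicity)
    then show "(if multiplicity p n = 0 then 1 else exp a * exp b ^ (multiplicity p n - 1)) =
        exp (a + b * (real (multiplicity p n) - 1))"
      by (simp add: exp_add of_nat_diff mult.commute flip: exp_of_nat_mult)
  qed
  also have "\<dots> = exp (\<Sum>p\<in>prime_factors n. a + b * (real (multiplicity p n) - 1))"
    by (simp add: exp_sum)
  also have "(\<Sum>p\<in>prime_factors n. a + b * (real (multiplicity p n) - 1)) =
      a * little_omega n + b * (real (big_omega n) - little_omega n)"
    by (simp add: big_omega_eq_sum little_omega_def sum.distrib sum_subtractf flip: sum_distrib_left)
  finally show ?thesis ..
qed

lemma sum_inverse_squares_primes_le: "(\<Sum>p\<in>primes_in 1 x. 1 / (real p)\<^sup>2) \<le> 1"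
proof -
  have *: "(\<Sum>k=2..m. 1 / (real k)\<^sup>2) \<le> 1 - 1 / real m" if "1 \<le> m" for m
    using that
  proof (induction m rule: dec_induct)
    case (step m)
    have "1 / (real (Suc m))\<^sup>2 \<le> 1 / real m - 1 / real (Suc m)"
    proof -
      have "1 / (real (Suc m))\<^sup>2 \<le> 1 / (real m * real (Suc m))"
        using step unfolding power2_eq_square by (intro divide_left_mono mult_right_mono mult_pos_pos) auto
      also have "\<dots> = 1 / real m - 1 / real (Suc m)" using step by (simp add: field_simps)
      finally show ?thesis .
    qed
    then show ?case using step by simp
  qed simp
  \<comment> \<open>The upper end is raised by 1 so that it is at least 1, where the telescoping
    bound starts.\<close>
  have "(\<Sum>p\<in>primes_in 1 x. 1 / (real p)\<^sup>2) \<le> (\<Sum>k=2..nat \<lfloor>x\<rfloor> + 1. 1 / (real k)\<^sup>2)"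
    by (intro sum_mono2) (auto simp: primes_in_def prime_ge_2_nat le_SucI le_nat_floor)
  also have "\<dots> \<le> 1" using *[of "nat \<lfloor>x\<rfloor> + 1"] by (smt (verit) divide_nonneg_nonneg le_add2 of_nat_0_le_iff)
  finally show ?thesis .
qed

text \<open>Exponential moments of the number of prime factors. Distinct primes cost
  \<open>(exp a - 1) / p\<close> and so a multiple of \<open>a * ln (ln N)\<close>, whereas
  repetitions cost only the convergent sum over \<open>1 / p\<^sup>2\<close>: hence two separate
  parameters, and a fixed \<open>b\<close> costs a bounded factor.\<close>

lemma sum_exp_omega_le:
  fixes a b N :: real
  assumes N: "exp (exp 8) \<le> N" and a: "0 \<le> a" "a \<le> 1/5" and b: "0 \<le> b" "b \<le> 1/5"
  shows "(\<Sum>n=1..nat \<lfloor>N\<rfloor>. exp (a * little_omega n + b * (real (big_omega n) - little_omega n)))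
           \<le> N * exp (120 * a * ln (ln N) + 4)"
proof -
  define M where "M = nat \<lfloor>N\<rfloor>"
  define P where "P = primes_in 1 N"
  define \<phi> where "\<phi> = (\<lambda>k::nat. if k = 0 then 1 else exp a * exp b ^ (k - 1))"
  define c where "c = (\<lambda>p. (exp a - 1) / real p + 4 * exp a * (exp b - 1) / (real p)\<^sup>2)"
  have N0: "0 < N" using N exp_gt_zero[of "exp 8 :: real"] by linarith
  have ea: "1 \<le> exp a" "exp a \<le> 1 + 2 * a" and eb: "1 \<le> exp b" "exp b \<le> 1 + 2 * b"
  proof -
    show "exp a \<le> 1 + 2 * a" using exp_bound[of a] a mult_left_mono[of a 1 a] by (simp add: power2_eq_square)
    show "exp b \<le> 1 + 2 * b" using exp_bound[of b] b mult_left_mono[of b 1 b] by (simp add: power2_eq_square)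
  qed (use a b in auto)
  have "(\<Sum>n=1..M. exp (a * little_omega n + b * (real (big_omega n) - little_omega n))) =
        (\<Sum>n=1..M. \<Prod>p\<in>P. \<phi> (multiplicity p n))"
  proof (intro sum.cong refl)
    fix n assume "n \<in> {1..M}"
    then have "n \<in> {n. 1 \<le> n \<and> real n \<le> N}" by (simp only: real_bounded_index_set M_def)
    then show "exp (a * little_omega n + b * (real (big_omega n) - little_omega n)) = (\<Prod>p\<in>P. \<phi> (multiplicity p n))"
      by (subst exp_omega_eq_prod) (auto simp: P_def \<phi>_def)
  qed
  also have "\<dots> \<le> real M * (\<Prod>p\<in>P. 1 + c p)"
  proof (rule sum_product_multiplicity_le)
    show "mono \<phi>"
    proof (rule monoI)
      fix i j :: nat assume ij: "i \<le> j"
      have "1 * 1 \<le> exp a * exp b ^ (j - 1)" using ea eb by (intro mult_mono one_le_power) auto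
      moreover have "exp b ^ (i - 1) \<le> exp b ^ (j - 1)" using ij eb by (intro power_increasing) auto
      ultimately show "\<phi> i \<le> \<phi> j" using ij by (auto simp: \<phi>_def)
    qed
    fix p J assume "p \<in> P"
    then have "2 \<le> real p" by (auto simp: P_def primes_in_def dest: prime_ge_2_nat)
    then show "1 + (\<Sum>k=1..J. (\<phi> k - \<phi> (k - 1)) / real p ^ k) \<le> 1 + c p"
      unfolding \<phi>_def c_def add.assoc[symmetric]
      using ea eb b by (intro euler_factor_le) auto
  qed (unfold P_def, rule finite_primes_in, auto simp: primes_in_def \<phi>_def)
  finally have 1: "(\<Sum>n=1..M. exp (a * little_omega n + b * (real (big_omega n) - little_omega n)))
     \<le> real M * (\<Prod>p\<in>P. 1 + c p)" .
  have "(\<Prod>p\<in>P. 1 + c p) \<le> (\<Prod>p\<in>P. exp (c p))"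
    using ea eb by (intro prod_mono) (auto simp: c_def intro!: exp_ge_add_one_self add_nonneg_nonneg)
  also have "\<dots> = exp (\<Sum>p\<in>P. c p)" by (simp add: exp_sum P_def)
  also have "(\<Sum>p\<in>P. c p) = (exp a - 1) * reciprocal_sum 1 N + 4 * exp a * (exp b - 1) * (\<Sum>p\<in>P. 1 / (real p)\<^sup>2)"
    by (simp add: c_def sum.distrib reciprocal_sum_def P_def sum_distrib_left)
  also have "\<dots> \<le> (2 * a) * (60 * ln (ln N)) + 4 * 1"
  proof (intro add_mono mult_mono)
    show "reciprocal_sum 1 N \<le> 60 * ln (ln N)" by (rule reciprocal_sum_le_log_log[OF N])
    have "exp a * (exp b - 1) \<le> (7/5) * (2/5)" using ea eb a b by (intro mult_mono) auto
    then show "4 * exp a * (exp b - 1) \<le> 4" by simp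
    show "(\<Sum>p\<in>P. 1 / (real p)\<^sup>2) \<le> 1" unfolding P_def by (rule sum_inverse_squares_primes_le)
  qed (use ea a in \<open>auto intro: sum_nonneg\<close>)
  finally have "(\<Prod>p\<in>P. 1 + c p) \<le> exp (120 * a * ln (ln N) + 4)"
    by (simp add: mult.assoc)
  then have "real M * (\<Prod>p\<in>P. 1 + c p) \<le> real M * exp (120 * a * ln (ln N) + 4)"
    by (rule mult_left_mono) simp
  also have "\<dots> \<le> N * exp (120 * a * ln (ln N) + 4)"
    using N0 by (intro mult_right_mono) (auto simp: M_def)
  finally show ?thesis using 1 unfolding M_def by linarith
qed

section \<open>Turan's variance inequality\<close>

lemma card_multiples:
  assumes "0 < d"
  shows "(\<Sum>n=1..M. if d dvd n then 1 else 0 :: real) = real (M div d)"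
proof -
  have "(\<Sum>n=1..M. if d dvd n then 1 else 0 :: real) = (\<Sum>n | n \<in> {1..M} \<and> d dvd n. 1)"
    by (simp only: sum.inter_filter[OF finite_atLeastAtMost])
  also have "\<dots> = (\<Sum>m=1..M div d. 1)" by (rule sum_multiples[OF assms])
  finally show ?thesis by simp
qed

definition omega_on :: "nat set \<Rightarrow> nat \<Rightarrow> nat" where
  "omega_on A n = card {p \<in> A. p dvd n}"

lemma real_omega_on: "finite A \<Longrightarrow> real (omega_on A n) = (\<Sum>p\<in>A. if p dvd n then 1 else 0)"
  by (simp add: omega_on_def flip: sum.inter_filter)

text \<open>Expand the square. The first moment is needed from below, where the floors lose at most
  \<open>card A \<le> M\<close> in total. The second is needed from above: distinct primes
  contribute at most \<open>M / (p * q)\<close> and the diagonal \<open>M / p\<close>. The terms in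
  \<open>L\<^sup>2\<close> cancel.\<close>

lemma turan_variance_le:
  fixes A :: "nat set"
  defines "\<nu> \<equiv> \<lambda>n. real (omega_on A n)" and "L \<equiv> \<Sum>p\<in>A. 1 / real p"
  assumes A: "\<And>p. p \<in> A \<Longrightarrow> prime p \<and> p \<le> M"
  shows "(\<Sum>n=1..M. (\<nu> n - L)\<^sup>2) \<le> 3 * real M * L"
proof -
  have sub: "A \<subseteq> {1..M}"
    using A by (auto simp: Suc_le_eq prime_gt_0_nat)
  then have fin: "finite A" by (rule finite_subset) simp
  have \<nu>_eq: "\<nu> = (\<lambda>n. \<Sum>p\<in>A. if p dvd n then 1 else 0)"
    using fin by (simp add: \<nu>_def real_omega_on fun_eq_iff)
  have cA: "real (card A) \<le> real M" using card_mono[OF _ sub] by simp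
  have L0: "0 \<le> L" by (simp add: L_def sum_nonneg)
  have pos: "0 < p" if "p \<in> A" for p using A[OF that] by (simp add: prime_gt_0_nat)
  have "(\<Sum>n=1..M. \<nu> n) = (\<Sum>p\<in>A. real (M div p))"
    unfolding \<nu>_eq by (subst sum.swap) (intro sum.cong refl card_multiples pos)
  also have "\<dots> \<ge> (\<Sum>p\<in>A. real M / real p - 1)"
  proof (rule sum_mono)
    fix p assume "p \<in> A"
    show "real M / real p - 1 \<le> real (M div p)"
      using floor_divide_of_nat_eq[of M p, where ?'a = real] floor_correct[of "real M / real p"] by linarith
  qed
  finally have S1: "real M * L - real M \<le> (\<Sum>n=1..M. \<nu> n)"
    using cA by (simp add: L_def sum_subtractf sum_distrib_left)
  have "(\<Sum>n=1..M. (\<nu> n)\<^sup>2) = (\<Sum>n=1..M. \<Sum>p\<in>A. \<Sum>q\<in>A. if p dvd n \<and> q dvd n then 1 else 0)"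
    unfolding \<nu>_eq power2_eq_square sum_product by (intro sum.cong refl) auto
  also have "\<dots> = (\<Sum>p\<in>A. \<Sum>q\<in>A. \<Sum>n=1..M. if p dvd n \<and> q dvd n then 1 else 0)"
    by (subst sum.swap, rule sum.cong[OF refl], rule sum.swap)
  also have "\<dots> \<le> (\<Sum>p\<in>A. \<Sum>q\<in>A. real M * (1 / real p * (1 / real q)) + (if p = q then real M * (1 / real p) else 0))"
  proof (intro sum_mono)
    fix p q assume p: "p \<in> A" and q: "q \<in> A"
    show "(\<Sum>n=1..M. if p dvd n \<and> q dvd n then 1 else 0) \<le>
       real M * (1 / real p * (1 / real q)) + (if p = q then real M * (1 / real p) else 0)"
    proof (cases "p = q")
      case True
      have "real (M div p) \<le> real M * (1 / real p)"
        using of_nat_div_le_of_nat[where ?'a = real, of M p] by simp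
      then show ?thesis using card_multiples[OF pos[OF p], of M] True by (simp add: add_increasing)
    next
      case False
      then have "coprime p q" using A p q by (simp add: primes_coprime)
      then have eq: "p dvd n \<and> q dvd n \<longleftrightarrow> p * q dvd n" for n by (auto intro: divides_mult)
      have "real (M div (p * q)) \<le> real M * (1 / real p * (1 / real q))"
        using of_nat_div_le_of_nat[where ?'a = real, of M "p * q"] by simp
      then show ?thesis using card_multiples[of "p * q" M] pos p q False by (simp add: eq)
    qed
  qed
  also have "\<dots> = real M * L\<^sup>2 + real M * L"
  proof -
    have "L\<^sup>2 = (\<Sum>p\<in>A. \<Sum>q\<in>A. 1 / real p * (1 / real q))"
      by (simp only: L_def power2_eq_square sum_product)
    then have "(\<Sum>p\<in>A. \<Sum>q\<in>A. real M * (1 / real p * (1 / real q))) = real M * L\<^sup>2"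
      by (simp only: sum_distrib_left)
    moreover have "(\<Sum>p\<in>A. \<Sum>q\<in>A. if p = q then real M * (1 / real p) else 0) = real M * L"
      using fin by (simp add: L_def sum_distrib_left)
    ultimately show ?thesis by (simp only: sum.distrib)
  qed
  finally have S2: "(\<Sum>n=1..M. (\<nu> n)\<^sup>2) \<le> real M * L\<^sup>2 + real M * L" .
  have "(\<Sum>n=1..M. (\<nu> n - L)\<^sup>2) = (\<Sum>n=1..M. (\<nu> n)\<^sup>2) - 2 * L * (\<Sum>n=1..M. \<nu> n) + real M * L\<^sup>2"
    by (simp add: power2_diff sum.distrib sum_subtractf sum_distrib_left algebra_simps)
  also have "\<dots> \<le> (real M * L\<^sup>2 + real M * L) - 2 * L * (real M * L - real M) + real M * L\<^sup>2"
    using S1 S2 L0 by (intro add_mono diff_mono mult_left_mono) auto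
  also have "\<dots> = 3 * real M * L" by (simp add: power2_eq_square algebra_simps)
  finally show ?thesis .
qed

section \<open>Elementary estimates for exponentials and binomial expansions\<close>

lemma square_le_exp:
  assumes "0 \<le> (x::real)"
  shows "x\<^sup>2 \<le> 200 * exp (x / 10)"
proof -
  have "1 + x / 10 + (x / 10)\<^sup>2 / 2 \<le> exp (x / 10)"
    using assms by (intro exp_lower_Taylor_quadratic) auto
  then show ?thesis using assms by (simp add: power2_eq_square field_simps)
qed

text \<open>The sixth power of \<open>x / 6 \<le> exp (x / 6)\<close>, with
  \<open>6 ^ 6 = 46656\<close>. It absorbs the square of a cubic remainder into an exponential
  moment.\<close>

lemma sixth_power_le_exp:
  assumes "0 \<le> (x::real)"
  shows "x ^ 6 \<le> 46656 * exp x"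
proof -
  have "(x / 6) ^ 6 \<le> exp (x / 6) ^ 6"
    using assms exp_ge_add_one_self[of "x / 6"] by (intro power_mono) linarith+
  also have "\<dots> = exp x" by (simp flip: exp_of_nat_mult)
  finally show ?thesis by (simp add: power_divide)
qed

text \<open>By Pascal's rule the second-order remainder \<open>r w\<close> satisfies
  \<open>r (w + 1) = (1 + t) * r w + (w choose 2) * t ^ 3\<close>; the induction closes because
  \<open>w ^ 3 + w\<^sup>2 \<le> (w + 1) ^ 3\<close>.\<close>

lemma binomial_remainder_le:
  fixes t :: real
  shows "\<bar>(1 + t) ^ w - (\<Sum>k\<le>2. real (w choose k) * t ^ k)\<bar> \<le> (real w * \<bar>t\<bar>) ^ 3 * exp (real w * \<bar>t\<bar>)"
proof -
  have s: "(\<Sum>k\<le>2. real (w choose k) * t ^ k) = 1 + real w * t + real (w choose 2) * t\<^sup>2" for w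
    by (simp add: numeral_2_eq_2)
  have "\<bar>(1 + t) ^ w - (1 + real w * t + real (w choose 2) * t\<^sup>2)\<bar> \<le> (real w * \<bar>t\<bar>) ^ 3 * (1 + \<bar>t\<bar>) ^ w"
  proof (induction w)
    case (Suc w)
    let ?r = "\<lambda>w. (1 + t) ^ w - (1 + real w * t + real (w choose 2) * t\<^sup>2)"
    have "real (Suc w choose 2) = real (w choose 2) + real w"
      by (simp add: numeral_2_eq_2)
    then have "?r (Suc w) = (1 + t) * ?r w + real (w choose 2) * t ^ 3"
      by (simp add: algebra_simps power2_eq_square power3_eq_cube)
    then have "\<bar>?r (Suc w)\<bar> \<le> \<bar>(1 + t) * ?r w\<bar> + \<bar>real (w choose 2) * t ^ 3\<bar>"
      by (simp only: abs_triangle_ineq)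
    then have "\<bar>?r (Suc w)\<bar> \<le> \<bar>1 + t\<bar> * \<bar>?r w\<bar> + real (w choose 2) * \<bar>t\<bar> ^ 3"
      by (simp only: abs_mult abs_of_nat power_abs)
    also have "\<dots> \<le> (1 + \<bar>t\<bar>) * ((real w * \<bar>t\<bar>) ^ 3 * (1 + \<bar>t\<bar>) ^ w) + (real w)\<^sup>2 * \<bar>t\<bar> ^ 3 * (1 + \<bar>t\<bar>) ^ Suc w"
    proof (rule add_mono)
      show "\<bar>1 + t\<bar> * \<bar>?r w\<bar> \<le> (1 + \<bar>t\<bar>) * ((real w * \<bar>t\<bar>) ^ 3 * (1 + \<bar>t\<bar>) ^ w)"
        by (intro mult_mono Suc.IH) auto
      have "real (w choose 2) \<le> real (w * (w - 1))"
        unfolding choose_two of_nat_le_iff by simp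
      also have "\<dots> \<le> (real w)\<^sup>2"
        unfolding of_nat_mult power2_eq_square by (intro mult_left_mono) auto
      finally have "real (w choose 2) * \<bar>t\<bar> ^ 3 * 1 \<le> (real w)\<^sup>2 * \<bar>t\<bar> ^ 3 * (1 + \<bar>t\<bar>) ^ Suc w"
        by (intro mult_mono one_le_power) auto
      then show "real (w choose 2) * \<bar>t\<bar> ^ 3 \<le> (real w)\<^sup>2 * \<bar>t\<bar> ^ 3 * (1 + \<bar>t\<bar>) ^ Suc w" by simp
    qed
    also have "\<dots> = (real w ^ 3 + (real w)\<^sup>2) * \<bar>t\<bar> ^ 3 * (1 + \<bar>t\<bar>) ^ Suc w"
      by (simp add: power_mult_distrib algebra_simps)
    also have "\<dots> \<le> (real (Suc w)) ^ 3 * \<bar>t\<bar> ^ 3 * (1 + \<bar>t\<bar>) ^ Suc w"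
    proof (intro mult_right_mono)
      show "real w ^ 3 + (real w)\<^sup>2 \<le> (real (Suc w)) ^ 3"
        by (simp add: power2_eq_square power3_eq_cube algebra_simps)
    qed auto
    finally show ?case by (simp add: power_mult_distrib)
  qed (simp add: numeral_2_eq_2)
  also have "(1 + \<bar>t\<bar>) ^ w \<le> exp \<bar>t\<bar> ^ w"
    by (intro power_mono) (auto simp: exp_ge_add_one_self)
  also have "exp \<bar>t\<bar> ^ w = exp (real w * \<bar>t\<bar>)" by (simp add: exp_of_nat_mult)
  finally show ?thesis unfolding s by (simp add: mult_left_mono)
qed

lemma abs_exp_diff_le: "\<bar>exp u - exp v\<bar> \<le> \<bar>u - v\<bar> * exp (max u v)" for u v :: real
proof -
  have *: "exp u - exp v \<le> (u - v) * exp u" if "v \<le> u" for u v :: real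
  proof -
    have "exp u * (1 + (v - u)) \<le> exp u * exp (v - u)"
      by (intro mult_left_mono exp_ge_add_one_self) auto
    then show ?thesis by (simp add: algebra_simps flip: exp_add)
  qed
  show ?thesis
    using *[of u v] *[of v u] by (cases "u \<le> v") (auto simp: max_def)
qed

lemma abs_ln_one_plus_le:
  fixes t :: real
  assumes "\<bar>t\<bar> \<le> 1/2"
  shows "\<bar>ln (1 + t)\<bar> \<le> 2 * \<bar>t\<bar>" "ln (1 + t) \<le> \<bar>t\<bar>"
proof -
  have 1: "ln (1 + t) \<le> t" using assms by (intro ln_add_one_self_le_self2) auto
  have "ln (1 / (1 + t)) \<le> 1 / (1 + t) - 1" using assms by (intro ln_le_minus_one) auto
  also have "1 / (1 + t) - 1 = - t / (1 + t)" using assms by (simp add: field_simps)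
  also have "\<dots> \<le> \<bar>t\<bar> / (1 + t)" using assms by (intro divide_right_mono) auto
  also have "\<dots> \<le> \<bar>t\<bar> / (1 / 2)" using assms by (intro divide_left_mono) auto
  finally have 2: "- ln (1 + t) \<le> 2 * \<bar>t\<bar>" using assms ln_div[of 1 "1 + t"] by (auto split: if_splits)
  show "\<bar>ln (1 + t)\<bar> \<le> 2 * \<bar>t\<bar>" "ln (1 + t) \<le> \<bar>t\<bar>" using 1 2 by linarith+
qed

text \<open>Grouping by cardinality. It turns a truncated binomial expansion in the number of prime
  divisors into a sum over products of few primes.\<close>

lemma sum_small_subsets:
  assumes "finite A"
  shows "(\<Sum>S | S \<subseteq> A \<and> card S \<le> m. F (card S)) = (\<Sum>k\<le>m. real (card A choose k) * F k)"
proof -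
  have fin: "finite {S. S \<subseteq> A \<and> card S \<le> m}"
    by (rule finite_subset[of _ "Pow A"]) (use assms in auto)
  have "(\<Sum>S | S \<subseteq> A \<and> card S \<le> m. F (card S)) =
        (\<Sum>k\<le>m. \<Sum>S | S \<in> {S. S \<subseteq> A \<and> card S \<le> m} \<and> card S = k. F (card S))"
    by (rule sum.group[symmetric]) (use fin in auto)
  also have "\<dots> = (\<Sum>k\<le>m. \<Sum>S | S \<subseteq> A \<and> card S = k. F k)"
    by (intro sum.cong) auto
  also have "\<dots> = (\<Sum>k\<le>m. real (card A choose k) * F k)"
    by (simp add: n_subsets[OF assms])
  finally show ?thesis .
qed

lemma omega_on_Un:
  assumes "finite A" "finite B" "A \<inter> B = {}"
  shows "omega_on (A \<union> B) n = omega_on A n + omega_on B n"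
proof -
  have "{p \<in> A \<union> B. p dvd n} = {p \<in> A. p dvd n} \<union> {p \<in> B. p dvd n}" by auto
  then show ?thesis
    using assms unfolding omega_on_def by (subst card_Un_disjoint[symmetric]) auto
qed

lemma little_omega_eq_omega_on:
  assumes "1 \<le> n" "real n \<le> N"
  shows "little_omega n = omega_on (primes_in 1 N) n"
proof -
  have "prime_factors n = {p \<in> primes_in 1 N. p dvd n}"
  proof (intro equalityI subsetI)
    fix p assume "p \<in> prime_factors n"
    then have "prime p" "p dvd n" "p \<le> n" using assms by (auto intro: dvd_imp_le simp: prime_factors_dvd)
    then show "p \<in> {p \<in> primes_in 1 N. p dvd n}" using assms by (auto simp: primes_in_1)
  qed (use assms in \<open>auto simp: primes_in_1 prime_factors_dvd\<close>)
  then show ?thesis by (simp add: little_omega_def omega_on_def)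
qed

lemma card_primes_in_le:
  assumes "0 \<le> y"
  shows "real (card (primes_in 1 y)) \<le> y"
proof -
  have "primes_in 1 y \<subseteq> {1..nat \<lfloor>y\<rfloor>}" by (auto simp: primes_in_def le_nat_floor)
  from card_mono[OF finite_atLeastAtMost this] have "card (primes_in 1 y) \<le> nat \<lfloor>y\<rfloor>" by simp
  then show ?thesis using assms by linarith
qed

section \<open>The four bounds\<close>

text \<open>The threshold for \<open>N\<close> makes \<open>ln (ln N)\<close> at least 40, on which
  the later numerical comparisons rest.\<close>

locale minor_arc_parameters =
  fixes N K Q Q0 :: real
  assumes N: "exp (exp 40) \<le> N"
    and K: "1 \<le> K"
    and Q: "sqrt N \<le> Q" "Q \<le> N"
    and Q0: "N * ln N / Q \<le> Q0"
begin

definition lam :: real where "lam = ln (ln N)"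
definition w :: real where "w = 2 * N / Q"
text \<open>The fourth root is dictated by the second-order expansion of the powers: it uses about
  \<open>y\<^sup>2\<close> products of two primes, and the square of that number times
  \<open>Q\<close> is \<open>w * Q = 2 * N\<close>.\<close>

definition y :: real where "y = w powr (1/4)"
text \<open>The logarithmic factor of the bounds for the prime counts and their powers.\<close>

definition l :: real where "l = ln (ln N / ln w)"
definition L :: real where "L = reciprocal_sum y N"

lemma N_pos: "0 < N"
  using N exp_gt_zero[of "exp 40 :: real"] by linarith

lemma ln_N: "exp 40 \<le> ln N" "41 \<le> ln N"
proof -
  show "exp 40 \<le> ln N" using N N_pos by (subst ln_ge_iff) auto
  then show "41 \<le> ln N" using exp_ge_add_one_self[of "40::real"] by linarith
qed

lemma lam_ge: "40 \<le> lam"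
  unfolding lam_def using ln_N by (subst ln_ge_iff) auto

lemma N_ge: "41 \<le> N" "exp (exp 8) \<le> N"
proof -
  show "41 \<le> N" using ln_N(2) ln_le_minus_one[OF N_pos] by linarith
  have "exp (exp 8) \<le> exp (exp (40::real))" by simp
  then show "exp (exp 8) \<le> N" using N by linarith
qed

lemma Q_ge: "2 \<le> Q"
proof -
  have "2 \<le> sqrt N" using N_ge by (intro real_le_rsqrt) auto
  then show ?thesis using Q by linarith
qed

lemma w_bounds: "2 \<le> w" "w \<le> N" "w \<le> 2 * sqrt N" "w * Q = 2 * N"
proof -
  show wQ: "w * Q = 2 * N" using Q_ge by (simp add: w_def)
  show "2 \<le> w" using Q Q_ge by (simp add: w_def field_simps)
  show "w \<le> N" using Q_ge N_pos by (simp add: w_def field_simps)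
  have "w \<le> 2 * N / sqrt N"
    unfolding w_def using Q N_pos Q_ge by (intro divide_left_mono) auto
  also have "\<dots> = 2 * sqrt N" using N_pos by (simp add: real_div_sqrt flip: times_divide_eq_right)
  finally show "w \<le> 2 * sqrt N" .
qed

text \<open>The lower bound on \<open>Q0\<close> enters here. All divisors used later are at most
  \<open>y\<^sup>2 \<le> w\<close>, hence within reach of
  \<open>minor_arc_separation\<close>.\<close>

lemma w_le_KQ0: "w \<le> K * Q0"
proof -
  have "w \<le> N * ln N / Q"
    unfolding w_def using ln_N N_pos Q_ge by (intro divide_right_mono) auto
  then have "w \<le> Q0" using Q0 by linarith
  then show ?thesis using K w_bounds(1) mult_mono[of 1 K w Q0] by simp
qed

lemma y_bounds: "1 < y" "y ^ 4 = w" "y \<le> y\<^sup>2" "y\<^sup>2 \<le> w" "ln y = ln w / 4" "y \<le> N"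
proof -
  show y1: "1 < y" unfolding y_def using w_bounds(1) by (intro gr_one_powr) auto
  show y4: "y ^ 4 = w"
    unfolding y_def using w_bounds(1) by (simp add: powr_powr flip: powr_realpow)
  show yy: "y \<le> y\<^sup>2" using power_increasing[of 1 2 y] y1 by simp
  show yw: "y\<^sup>2 \<le> w" using power_increasing[of 2 4 y] y1 y4 by simp
  show "ln y = ln w / 4" unfolding y_def using w_bounds(1) by (simp add: ln_powr)
  show "y \<le> N" using yy yw w_bounds(2) by linarith
qed

lemma ln_w: "ln 2 \<le> ln w" "0 < ln w" "ln w \<le> 2/3 * ln N"
proof -
  show a: "ln 2 \<le> ln w" using w_bounds(1) by (subst ln_le_cancel_iff) auto
  show "0 < ln w" using a ln_2_bounds by linarith
  have "ln w \<le> ln (2 * sqrt N)" using w_bounds(1,3) N_pos by (subst ln_le_cancel_iff) auto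
  also have "\<dots> = ln 2 + ln N / 2" using N_pos by (simp add: ln_mult_pos ln_sqrt)
  finally show "ln w \<le> 2/3 * ln N" using ln_2_bounds ln_N by linarith
qed

text \<open>From \<open>ln w \<le> 2/3 * ln N\<close>, a consequence of
  \<open>Q \<ge> sqrt N\<close>. It allows errors of size \<open>N\<close> to be absorbed into
  \<open>N * l\<close>.\<close>

lemma l_ge: "1/3 \<le> l"
proof -
  have "ln w / ln N \<le> 2/3" using ln_w ln_N by (simp add: field_simps)
  moreover have "ln (ln w / ln N) \<le> ln w / ln N - 1"
    using ln_w ln_N by (intro ln_le_minus_one) auto
  moreover have "l = - ln (ln w / ln N)"
    unfolding l_def using ln_w ln_N by (subst ln_inverse[symmetric]) auto
  ultimately show ?thesis by linarith
qed

lemma L_bounds: "0 \<le> L" "L \<le> 60 * lam" "L \<le> 315 * l"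
proof -
  show "0 \<le> L" by (simp add: L_def)
  show "L \<le> 60 * lam" unfolding L_def lam_def by (rule reciprocal_sum_le_log_log[OF N_ge(2)])
  have "L \<le> 30 * (log 2 (ln N / ln y) + 1)"
    unfolding L_def using y_bounds ln_w by (intro reciprocal_sum_le_log_log_ratio) auto
  \<comment> \<open>Passing from \<open>y\<close> to \<open>w\<close> costs two doublings of the
    logarithm; the resulting \<open>90 + 45 * l\<close> is at most \<open>315 * l\<close> because
    \<open>l \<ge> 1 / 3\<close>.\<close>
  also have "ln N / ln y = 2 ^ 2 * (ln N / ln w)" by (simp add: y_bounds(5))
  also have "log 2 \<dots> = 2 + l / ln 2"
    using ln_w ln_N log_pow_cancel[of 2 2] by (subst log_mult_pos) (auto simp: l_def log_def)
  also have "l / ln 2 \<le> l * (3 / 2)"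
    using l_ge ln_2_bounds mult_left_mono[of "2/3" "ln 2" l] by (simp add: field_simps)
  finally show "L \<le> 315 * l" using l_ge by simp
qed

lemma M_le: "real (nat \<lfloor>N\<rfloor>) \<le> N"
  using N_pos by linarith

lemma in_range:
  assumes "n \<in> {1..nat \<lfloor>N\<rfloor>}"
  shows "1 \<le> n" "real n \<le> N"
proof -
  have "n \<in> {n. 1 \<le> n \<and> real n \<le> N}" using assms by (simp only: real_bounded_index_set)
  then show "1 \<le> n" "real n \<le> N" by simp_all
qed

abbreviation omega_low :: "nat \<Rightarrow> nat" where "omega_low \<equiv> omega_on (primes_in 1 y)"
abbreviation omega_high :: "nat \<Rightarrow> nat" where "omega_high \<equiv> omega_on (primes_in y N)"

lemma little_omega_split:
  assumes "n \<in> {1..nat \<lfloor>N\<rfloor>}"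
  shows "little_omega n = omega_low n + omega_high n"
proof -
  have "1 \<le> y" using y_bounds by simp
  note split = primes_in_split[OF this y_bounds(6)]
  show ?thesis
    using little_omega_eq_omega_on[OF in_range[OF assms]] split(2)
    by (simp add: split(1) omega_on_Un)
qed

section \<open>Weighted moments of the prime counts\<close>

text \<open>The square is absorbed into \<open>exp (e / 10)\<close> for the excess \<open>e\<close>
  of \<open>big_omega\<close> over \<open>little_omega\<close>. As
  \<open>2 / lam \<le> 1 / 10\<close>, the total weight on \<open>e\<close> is at most 1/5, and the
  weight \<open>2 / lam\<close> on \<open>little_omega\<close> costs only \<open>exp 240\<close>.
  The factor \<open>exp (2 * big_omega n / lam)\<close> comes from squaring powers of
  \<open>1 + 1 / R\<close> with \<open>\<bar>R\<bar> \<ge> lam\<close>.\<close>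

lemma excess_moment:
  "(\<Sum>n=1..nat \<lfloor>N\<rfloor>. (real (big_omega n) - little_omega n)\<^sup>2 * exp (2 * big_omega n / lam)) \<le> 200 * exp 244 * N"
proof -
  have "(real (big_omega n) - little_omega n)\<^sup>2 * exp (2 * big_omega n / lam) \<le>
     200 * exp ((2 / lam) * little_omega n + 1/5 * (real (big_omega n) - little_omega n))" for n
  proof -
    define e where "e = real (big_omega n) - little_omega n"
    have e: "0 \<le> e" using little_omega_le_big_omega[of n] by (simp add: e_def)
    have O: "real (big_omega n) = little_omega n + e" by (simp add: e_def)
    have "2 / lam \<le> 1 / 10" using lam_ge by (simp add: field_simps)
    then have le: "2 / lam * e \<le> 1 / 10 * e" using e by (intro mult_right_mono) auto
    have "2 * big_omega n / lam = 2 / lam * little_omega n + 2 / lam * e"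
      by (simp add: O add_divide_distrib distrib_left)
    then have "e / 10 + 2 * big_omega n / lam \<le> (2 / lam) * little_omega n + 1/5 * e"
      using le by linarith
    then have "exp (e / 10 + 2 * big_omega n / lam) \<le> exp ((2 / lam) * little_omega n + 1/5 * e)"
      by (simp only: exp_le_cancel_iff)
    then have "200 * (exp (e / 10) * exp (2 * big_omega n / lam)) \<le> 200 * exp ((2 / lam) * little_omega n + 1/5 * e)"
      by (simp add: exp_add)
    moreover have "e\<^sup>2 * exp (2 * big_omega n / lam) \<le> 200 * exp (e / 10) * exp (2 * big_omega n / lam)"
      by (intro mult_right_mono square_le_exp e) auto
    ultimately show ?thesis unfolding e_def[symmetric] by linarith
  qed
  then have "(\<Sum>n=1..nat \<lfloor>N\<rfloor>. (real (big_omega n) - little_omega n)\<^sup>2 * exp (2 * big_omega n / lam)) \<le>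
     (\<Sum>n=1..nat \<lfloor>N\<rfloor>. 200 * exp ((2 / lam) * little_omega n + 1/5 * (real (big_omega n) - little_omega n)))"
    by (intro sum_mono)
  also have "\<dots> \<le> 200 * (N * exp (120 * (2 / lam) * lam + 4))"
    unfolding sum_distrib_left[symmetric] lam_def
    by (intro mult_left_mono sum_exp_omega_le N_ge) (use lam_ge in \<open>auto simp: lam_def field_simps\<close>)
  also have "120 * (2 / lam) * lam + 4 = 244" using lam_ge by simp
  finally show ?thesis by (simp add: mult_ac)
qed

lemma excess_square_sum:
  "(\<Sum>n=1..nat \<lfloor>N\<rfloor>. (real (big_omega n) - little_omega n)\<^sup>2) \<le> 200 * exp 244 * N"
proof -
  have "(\<Sum>n=1..nat \<lfloor>N\<rfloor>. (real (big_omega n) - little_omega n)\<^sup>2 * 1) \<le>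
     (\<Sum>n=1..nat \<lfloor>N\<rfloor>. (real (big_omega n) - little_omega n)\<^sup>2 * exp (2 * big_omega n / lam))"
    using lam_ge by (intro sum_mono mult_left_mono) auto
  then show ?thesis using excess_moment by simp
qed

text \<open>Scaling by \<open>lam\<close> before applying \<open>sixth_power_le_exp\<close> produces
  the factor \<open>lam ^ 6\<close> and raises the weight on \<open>little_omega\<close> from
  \<open>2 / lam\<close> to \<open>3 / lam\<close>.\<close>

lemma sixth_moment:
  "(\<Sum>n=1..nat \<lfloor>N\<rfloor>. real (little_omega n) ^ 6 * exp (2 * little_omega n / lam)) \<le> 46656 * exp 364 * lam ^ 6 * N"
proof -
  have "real (little_omega n) ^ 6 * exp (2 * little_omega n / lam) \<le>
     46656 * lam ^ 6 * exp ((3 / lam) * little_omega n + 0 * (real (big_omega n) - little_omega n))" for n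
  proof -
    have "real (little_omega n) ^ 6 = lam ^ 6 * (little_omega n / lam) ^ 6"
      using lam_ge by (simp add: power_divide)
    also have "\<dots> \<le> lam ^ 6 * (46656 * exp (little_omega n / lam))"
      using lam_ge by (intro mult_left_mono sixth_power_le_exp) auto
    finally have "real (little_omega n) ^ 6 * exp (2 * little_omega n / lam) \<le>
       lam ^ 6 * (46656 * exp (little_omega n / lam)) * exp (2 * little_omega n / lam)"
      by (rule mult_right_mono) simp
    also have "\<dots> = 46656 * lam ^ 6 * exp (little_omega n / lam + 2 * little_omega n / lam)"
      by (simp only: exp_add mult_ac)
    also have "little_omega n / lam + 2 * little_omega n / lam =
      (3 / lam) * little_omega n + 0 * (real (big_omega n) - little_omega n)"
      using lam_ge by (simp add: field_simps)
    finally show ?thesis .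
  qed
  then have "(\<Sum>n=1..nat \<lfloor>N\<rfloor>. real (little_omega n) ^ 6 * exp (2 * little_omega n / lam)) \<le>
     (\<Sum>n=1..nat \<lfloor>N\<rfloor>. 46656 * lam ^ 6 * exp ((3 / lam) * little_omega n + 0 * (real (big_omega n) - little_omega n)))"
    by (intro sum_mono)
  also have "\<dots> \<le> 46656 * lam ^ 6 * (N * exp (120 * (3 / lam) * lam + 4))"
    unfolding sum_distrib_left[symmetric] lam_def
    by (intro mult_left_mono sum_exp_omega_le N_ge) (use lam_ge in \<open>auto simp: lam_def field_simps\<close>)
  also have "120 * (3 / lam) * lam + 4 = 364" using lam_ge by simp
  finally show ?thesis by (simp add: mult_ac)
qed

lemma variance_le: "(\<Sum>n=1..nat \<lfloor>N\<rfloor>. (real (omega_high n) - L)\<^sup>2) \<le> 3 * N * L"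
proof -
  have "(\<Sum>n=1..nat \<lfloor>N\<rfloor>. (real (omega_high n) - L)\<^sup>2) \<le> 3 * real (nat \<lfloor>N\<rfloor>) * L"
    unfolding L_def reciprocal_sum_def by (intro turan_variance_le) (auto simp: primes_in_def le_nat_floor)
  also have "\<dots> \<le> 3 * N * L"
    using M_le L_bounds by (intro mult_right_mono) auto
  finally show ?thesis .
qed

text \<open>
  The weight is bounded where \<open>big_omega n \<le> 480 * lam\<close>; elsewhere the whole term is dominated by
  an exponential moment of \<open>big_omega\<close>, with room to spare.
\<close>

lemma weighted_variance_le:
  "(\<Sum>n=1..nat \<lfloor>N\<rfloor>. (real (omega_high n) - L)\<^sup>2 * exp (2 * big_omega n / lam)) \<le> (3 * exp 960 * L + 200 * exp 4) * N"
proof -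
  have "(real (omega_high n) - L)\<^sup>2 * exp (2 * big_omega n / lam) \<le>
     exp 960 * (real (omega_high n) - L)\<^sup>2 +
     200 * exp (- 24 * lam) * exp (1/5 * little_omega n + 1/5 * (real (big_omega n) - little_omega n))"
    if n: "n \<in> {1..nat \<lfloor>N\<rfloor>}" for n
  proof (cases "real (big_omega n) \<le> 480 * lam")
    case True
    then have "2 * big_omega n / lam \<le> 960" using lam_ge by (simp add: field_simps)
    then have "(real (omega_high n) - L)\<^sup>2 * exp (2 * big_omega n / lam) \<le> (real (omega_high n) - L)\<^sup>2 * exp 960"
      by (intro mult_left_mono) auto
    then show ?thesis by (simp add: mult.commute add_increasing2)
  next
    case False
    define Z where "Z = real (big_omega n)"
    have Z: "480 * lam < Z" using False by (simp add: Z_def)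
    have "omega_high n \<le> big_omega n"
      using little_omega_split[OF n] little_omega_le_big_omega[of n] by linarith
    then have "real (omega_high n) \<le> Z" by (simp add: Z_def)
    \<comment> \<open>Both \<open>omega_high n\<close> and \<open>L \<le> 60 * lam\<close> are
      nonnegative and at most \<open>Z\<close>.\<close>
    then have "\<bar>real (omega_high n) - L\<bar> \<le> Z"
      using L_bounds(1,2) Z lam_ge by linarith
    then have "(real (omega_high n) - L)\<^sup>2 \<le> Z\<^sup>2"
      using abs_le_square_iff[of "real (omega_high n) - L" Z] Z lam_ge by simp
    also have "\<dots> \<le> 200 * exp (Z / 10)" using Z lam_ge by (intro square_le_exp) auto
    finally have "(real (omega_high n) - L)\<^sup>2 * exp (2 * Z / lam) \<le> 200 * exp (Z / 10) * exp (2 * Z / lam)"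
      by (intro mult_right_mono) auto
    also have "\<dots> = 200 * exp (Z / 10 + 2 * Z / lam)" by (simp add: exp_add)
    \<comment> \<open>With \<open>lam \<ge> 40\<close> the exponent is at most
      \<open>3 * Z / 20\<close>, and the spare \<open>Z / 20\<close> exceeds \<open>24 * lam\<close>
      since \<open>Z > 480 * lam\<close>. The 24 is what the moment with \<open>a = 1/5\<close>
      costs, so the two cancel.\<close>
    also have "\<dots> \<le> 200 * exp (- 24 * lam + Z / 5)"
    proof -
      have "2 * Z / lam \<le> 2 * Z / 40" using lam_ge Z by (intro divide_left_mono) auto
      then have "Z / 10 + 2 * Z / lam \<le> - 24 * lam + Z / 5" using Z by linarith
      then show ?thesis by simp
    qed
    also have "Z / 5 = 1/5 * little_omega n + 1/5 * (real (big_omega n) - little_omega n)"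
      by (simp add: Z_def field_simps)
    finally have "(real (omega_high n) - L)\<^sup>2 * exp (2 * Z / lam) \<le> 200 * (exp (- 24 * lam) *
        exp (1/5 * little_omega n + 1/5 * (real (big_omega n) - little_omega n)))"
      by (simp only: exp_add[of "- 24 * lam"])
    moreover have "0 \<le> exp 960 * (real (omega_high n) - L)\<^sup>2" by simp
    ultimately show ?thesis unfolding Z_def mult.assoc by (simp only: of_nat_mult of_nat_numeral)
  qed
  then have "(\<Sum>n=1..nat \<lfloor>N\<rfloor>. (real (omega_high n) - L)\<^sup>2 * exp (2 * big_omega n / lam)) \<le>
    (\<Sum>n=1..nat \<lfloor>N\<rfloor>. exp 960 * (real (omega_high n) - L)\<^sup>2 +
     200 * exp (- 24 * lam) * exp (1/5 * little_omega n + 1/5 * (real (big_omega n) - little_omega n)))"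
    by (intro sum_mono)
  also have "\<dots> = exp 960 * (\<Sum>n=1..nat \<lfloor>N\<rfloor>. (real (omega_high n) - L)\<^sup>2) +
     200 * exp (- 24 * lam) * (\<Sum>n=1..nat \<lfloor>N\<rfloor>. exp (1/5 * little_omega n + 1/5 * (real (big_omega n) - little_omega n)))"
    by (simp only: sum.distrib sum_distrib_left)
  also have "\<dots> \<le> exp 960 * (3 * N * L) + 200 * exp (- 24 * lam) * (N * exp (120 * (1/5) * lam + 4))"
    unfolding lam_def by (intro add_mono mult_left_mono variance_le sum_exp_omega_le N_ge) auto
  also have "\<dots> = exp 960 * (3 * N * L) + 200 * N * exp (- 24 * lam + (120 * (1/5) * lam + 4))"
    by (simp only: exp_add mult_ac)
  also have "- 24 * lam + (120 * (1/5) * lam + 4) = 4" by simp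
  finally show ?thesis by (simp add: algebra_simps)
qed

lemma card_low: "real (card (primes_in 1 y)) \<le> y"
  using y_bounds by (intro card_primes_in_le) auto

section \<open>The individual minor arc estimates\<close>

lemma minor_integral_one_le: "minor_integral (\<lambda>n. 1) N K Q0 Q \<le> 128 * Q"
proof -
  have "minor_integral (\<lambda>n. 1) N K Q0 Q \<le>
      128 * Q * (\<Sum>i\<in>{1::nat}. \<bar>1::real\<bar>)\<^sup>2 + 2 * (\<Sum>n=1..nat \<lfloor>N\<rfloor>. (0::real)\<^sup>2)"
  proof (rule minor_integral_le[where d = "\<lambda>i. i"])
    show "1 = complex_of_real ((\<Sum>i | i \<in> {1::nat} \<and> i dvd n. 1) + 0)" for n
    proof -
      have "{i. i \<in> {1::nat} \<and> i dvd n} = {1}" by auto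
      then show ?thesis by simp
    qed
  qed (use w_bounds(1) w_le_KQ0 K Q_ge in auto)
  then show ?thesis by simp
qed

text \<open>The remainder is -1 on the integers with a prime factor above \<open>z\<close>, and a
  union bound counts these by \<open>N * reciprocal_sum z N\<close>. The lower limit on
  \<open>u\<close> forces \<open>N / z \<ge> 2\<close>, which absorbs the \<open>+ 1\<close> of the
  dyadic bound.\<close>

lemma minor_integral_smooth_le:
  assumes z: "1 < z" "1 + ln 4 / ln N \<le> u" "u \<le> 2" "u = ln N / ln z"
  shows "minor_integral (smooth_indicator z) N K Q0 Q \<le> 128 * Q + 48 * N * ln u"
proof -
  have lnz: "0 < ln z" using z by simp
  have lnN: "ln N = u * ln z" using lnz z(4) by simp
  have "0 < ln 4 / ln N" using ln_N by simp
  then have u1: "1 < u" using z by linarith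
  have "z \<le> N"
  proof -
    have "1 * ln z \<le> ln N" unfolding lnN using lnz u1 by (intro mult_right_mono) auto
    then show ?thesis using z(1) N_pos by simp
  qed
  have "ln 4 \<le> (u - 1) * ln N" using z(2) ln_N by (simp add: field_simps)
  also have "\<dots> = u * ((u - 1) * ln z)" by (simp add: lnN)
  also have "\<dots> \<le> 2 * ((u - 1) * ln z)" using z u1 lnz by (intro mult_right_mono) auto
  finally have ln4: "ln 4 \<le> 2 * ((u - 1) * ln z)" .
  have ratio: "ln (N / z) = (u - 1) * ln z"
    using N_pos z(1) lnN by (simp add: ln_div algebra_simps)
  have ln4': "ln (4::real) = 2 * ln 2" using ln_realpow[of 2 2] by simp
  have "log 2 (N / z) = (u - 1) * ln z / ln 2" by (simp add: log_def ratio)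
  moreover have "ln 2 \<le> (u - 1) * ln z" using ln4 ln4' by linarith
  then have "1 \<le> (u - 1) * ln z / ln 2" by (simp add: field_simps)
  ultimately have "log 2 (N / z) + 1 \<le> 2 * ((u - 1) * ln z / ln 2)" by linarith
  then have "4 * (log 2 (N / z) + 1) / ln z \<le> 4 * (2 * ((u - 1) * ln z / ln 2)) / ln z"
    using lnz by (intro divide_right_mono mult_left_mono) auto
  then have "reciprocal_sum z N \<le> 4 * (2 * ((u - 1) * ln z / ln 2)) / ln z"
    using reciprocal_sum_le_log_ratio[OF z(1) \<open>z \<le> N\<close>] by (rule order_trans[rotated])
  also have "\<dots> = 8 * (u - 1) / ln 2" using lnz by simp
  also have "\<dots> \<le> 8 * (u - 1) / (2/3)" using u1 ln_2_bounds by (intro divide_left_mono) auto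
  finally have rec: "reciprocal_sum z N \<le> 12 * (u - 1)" by simp
  \<comment> \<open>Since \<open>u \<le> 2\<close>, \<open>u - 1\<close> is at most
    \<open>2 * ln u\<close>; this turns the bound \<open>12 * (u - 1)\<close> into
    \<open>24 * ln u\<close>.\<close>
  have "ln (1 / u) \<le> 1 / u - 1" using u1 by (intro ln_le_minus_one) auto
  then have "1 - 1 / u \<le> ln u" using u1 by (simp add: ln_div)
  moreover have "(u - 1) / 2 \<le> (u - 1) / u" using u1 z(3) by (intro divide_left_mono) auto
  ultimately have lnu: "(u - 1) / 2 \<le> ln u" using u1 by (simp add: diff_divide_distrib)

  define h where "h = (\<lambda>n. if \<exists>p\<in>primes_in z N. p dvd n then - 1 else 0 :: real)"
  have "minor_integral (smooth_indicator z) N K Q0 Q \<le>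
      128 * Q * (\<Sum>i\<in>{1::nat}. \<bar>1::real\<bar>)\<^sup>2 + 2 * (\<Sum>n=1..nat \<lfloor>N\<rfloor>. (h n)\<^sup>2)"
  proof (rule minor_integral_le[where d = "\<lambda>i. i"])
    fix n assume n: "1 \<le> n" "real n \<le> N"
    have "(\<exists>p\<in>primes_in z N. p dvd n) \<longleftrightarrow> \<not> (\<forall>p. prime p \<and> p dvd n \<longrightarrow> real p \<le> z)"
    proof
      assume "\<not> (\<forall>p. prime p \<and> p dvd n \<longrightarrow> real p \<le> z)"
      then obtain p where p: "prime p" "p dvd n" "z < real p" by auto
      then have "p \<le> n" using n by (auto intro: dvd_imp_le)
      then show "\<exists>p\<in>primes_in z N. p dvd n" using p n by (intro bexI[of _ p]) (auto simp: primes_in_def)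
    next
      assume "\<exists>p\<in>primes_in z N. p dvd n"
      then obtain p where "prime p" "p dvd n" "\<not> real p \<le> z" by (auto simp: primes_in_def)
      then show "\<not> (\<forall>p. prime p \<and> p dvd n \<longrightarrow> real p \<le> z)" by blast
    qed
    moreover have "{i. i \<in> {1::nat} \<and> i dvd n} = {1}" by auto
    ultimately show "smooth_indicator z n = complex_of_real ((\<Sum>i | i \<in> {1::nat} \<and> i dvd n. 1) + h n)"
      using n by (simp add: smooth_indicator_def h_def)
  qed (use w_bounds(1) w_le_KQ0 K Q_ge in auto)
  also have "(\<Sum>n=1..nat \<lfloor>N\<rfloor>. (h n)\<^sup>2) \<le> (\<Sum>n=1..nat \<lfloor>N\<rfloor>. \<Sum>p\<in>primes_in z N. if p dvd n then 1 else 0)"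
  proof (rule sum_mono)
    fix n
    show "(h n)\<^sup>2 \<le> (\<Sum>p\<in>primes_in z N. if p dvd n then 1 else 0)"
    proof (cases "\<exists>p\<in>primes_in z N. p dvd n")
      case True
      then obtain p where "p \<in> primes_in z N" "p dvd n" by auto
      then have "(1::real) \<le> (\<Sum>p\<in>primes_in z N. if p dvd n then 1 else 0)"
        using member_le_sum[of p "primes_in z N" "\<lambda>p. if p dvd n then 1 else 0 :: real"] by simp
      then show ?thesis using True by (simp add: h_def)
    qed (simp add: h_def sum_nonneg)
  qed
  also have "\<dots> = (\<Sum>p\<in>primes_in z N. real (nat \<lfloor>N\<rfloor> div p))"
    by (subst sum.swap) (intro sum.cong refl card_multiples, auto simp: primes_in_def prime_gt_0_nat)
  also have "\<dots> \<le> (\<Sum>p\<in>primes_in z N. N * (1 / real p))"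
  proof (rule sum_mono)
    fix p
    have "real (nat \<lfloor>N\<rfloor> div p) \<le> real (nat \<lfloor>N\<rfloor>) / real p" by (rule of_nat_div_le_of_nat)
    also have "\<dots> \<le> N / real p" using M_le by (intro divide_right_mono) auto
    finally show "real (nat \<lfloor>N\<rfloor> div p) \<le> N * (1 / real p)" by simp
  qed
  also have "\<dots> = N * reciprocal_sum z N" by (simp add: reciprocal_sum_def sum_distrib_left)
  also have "\<dots> \<le> N * (24 * ln u)"
    using rec lnu N_pos by (intro mult_left_mono) auto
  finally show ?thesis by simp
qed

lemma excess_bounds:
  assumes "\<omega> \<in> {little_omega, big_omega}"
  shows "little_omega n \<le> \<omega> n" "\<omega> n \<le> big_omega n"
  using assms little_omega_le_big_omega[of n] by auto

lemma square_add_le: "(a + b)\<^sup>2 \<le> 2 * a\<^sup>2 + 2 * b\<^sup>2" for a b :: real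
  using sum_squares_bound[of a b] by (simp add: power2_sum)

text \<open>The weights have total size \<open>L + card P\<close>. The square of \<open>L\<close>
  yields \<open>Q * lam\<^sup>2\<close>, and that of \<open>card P \<le> y\<close> costs at most
  \<open>Q * w = 2 * N\<close>. The remainder is the sum of the excess over
  \<open>little_omega\<close> and the deviation of \<open>omega_high\<close> from its mean.\<close>

lemma minor_integral_omega_le:
  assumes \<omega>: "\<omega> \<in> {little_omega, big_omega}"
  shows "minor_integral (\<lambda>n. of_nat (\<omega> n)) N K Q0 Q \<le>
           1000000 * (Q * lam\<^sup>2) + (10000 + 3000 * exp 244) * (N * l)"
proof -
  define P where "P = primes_in 1 y"
  define h where "h = (\<lambda>n. real (\<omega> n) - real (omega_low n) - L)"
  define g where "g = (\<lambda>i::nat. if i = 1 then L else 1)"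
  have fin: "finite P" and nP: "1 \<notin> P" by (simp_all add: P_def) (simp add: primes_in_def)
  have "minor_integral (\<lambda>n. of_nat (\<omega> n)) N K Q0 Q \<le>
      128 * Q * (\<Sum>i\<in>insert 1 P. \<bar>g i\<bar>)\<^sup>2 + 2 * (\<Sum>n=1..nat \<lfloor>N\<rfloor>. (h n)\<^sup>2)"
  proof (rule minor_integral_le[where d = "\<lambda>i. i"])
    fix i assume "i \<in> insert 1 P"
    then have "0 < i" "real i \<le> y" using y_bounds by (auto simp: P_def primes_in_def prime_gt_0_nat)
    then show "0 < i \<and> real i \<le> K * Q0" using y_bounds w_le_KQ0 by linarith
  next
    fix n
    have "{i. i \<in> insert 1 P \<and> i dvd n} = insert 1 {i \<in> P. i dvd n}" by auto
    then have "(\<Sum>i | i \<in> insert 1 P \<and> i dvd n. g i) = L + (\<Sum>i | i \<in> P \<and> i dvd n. g i)"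
      using fin nP by (simp add: g_def)
    also have "(\<Sum>i | i \<in> P \<and> i dvd n. g i) = (\<Sum>i | i \<in> P \<and> i dvd n. 1)"
      using nP by (intro sum.cong) (auto simp: g_def)
    finally show "of_nat (\<omega> n) = complex_of_real ((\<Sum>i | i \<in> insert 1 P \<and> i dvd n. g i) + h n)"
      by (simp add: h_def omega_on_def P_def)
  qed (use fin K Q_ge in auto)
  also have "(\<Sum>i\<in>insert 1 P. \<bar>g i\<bar>) = L + (\<Sum>i\<in>P. \<bar>g i\<bar>)"
    using fin nP L_bounds by (simp add: g_def)
  also have "(\<Sum>i\<in>P. \<bar>g i\<bar>) = real (card P)"
    using nP by (subst sum.cong[OF refl, of P _ "\<lambda>_. 1"]) (auto simp: g_def)
  finally have 1: "minor_integral (\<lambda>n. of_nat (\<omega> n)) N K Q0 Q \<le>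
      128 * Q * (L + real (card P))\<^sup>2 + 2 * (\<Sum>n=1..nat \<lfloor>N\<rfloor>. (h n)\<^sup>2)" .
  have "(L + real (card P))\<^sup>2 \<le> 2 * L\<^sup>2 + 2 * (real (card P))\<^sup>2" by (rule square_add_le)
  also have "\<dots> \<le> 2 * (60 * lam)\<^sup>2 + 2 * y\<^sup>2"
    using L_bounds card_low by (intro add_mono mult_left_mono power_mono) (auto simp: P_def)
  also have "\<dots> \<le> 7200 * lam\<^sup>2 + 2 * w" using y_bounds by (simp add: power_mult_distrib)
  finally have "Q * (L + real (card P))\<^sup>2 \<le> Q * (7200 * lam\<^sup>2 + 2 * w)"
    using Q_ge by (intro mult_left_mono) auto
  also have "\<dots> = 7200 * (Q * lam\<^sup>2) + 4 * N" using w_bounds(4) by (simp add: algebra_simps)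
  finally have 2: "Q * (L + real (card P))\<^sup>2 \<le> 7200 * (Q * lam\<^sup>2) + 4 * N" .
  have "(\<Sum>n=1..nat \<lfloor>N\<rfloor>. (h n)\<^sup>2) \<le>
     (\<Sum>n=1..nat \<lfloor>N\<rfloor>. 2 * (real (big_omega n) - little_omega n)\<^sup>2 + 2 * (real (omega_high n) - L)\<^sup>2)"
  proof (rule sum_mono)
    fix n assume n: "n \<in> {1..nat \<lfloor>N\<rfloor>}"
    have "h n = (real (\<omega> n) - little_omega n) + (real (omega_high n) - L)"
      using little_omega_split[OF n] by (simp add: h_def)
    then have "(h n)\<^sup>2 \<le> 2 * (real (\<omega> n) - little_omega n)\<^sup>2 + 2 * (real (omega_high n) - L)\<^sup>2"
      using square_add_le by simp
    moreover have "(real (\<omega> n) - little_omega n)\<^sup>2 \<le> (real (big_omega n) - little_omega n)\<^sup>2"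
      using excess_bounds[OF \<omega>, of n] by (intro power_mono) auto
    ultimately show "(h n)\<^sup>2 \<le> 2 * (real (big_omega n) - little_omega n)\<^sup>2 + 2 * (real (omega_high n) - L)\<^sup>2"
      by linarith
  qed
  also have "\<dots> = 2 * (\<Sum>n=1..nat \<lfloor>N\<rfloor>. (real (big_omega n) - little_omega n)\<^sup>2) + 2 * (\<Sum>n=1..nat \<lfloor>N\<rfloor>. (real (omega_high n) - L)\<^sup>2)"
    by (simp only: sum.distrib sum_distrib_left)
  also have "\<dots> \<le> 2 * (200 * exp 244 * N) + 2 * (3 * N * L)"
    using excess_square_sum variance_le by linarith
  finally have 3: "(\<Sum>n=1..nat \<lfloor>N\<rfloor>. (h n)\<^sup>2) \<le> 2 * (200 * exp 244 * N) + 2 * (3 * N * L)" .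
  have NL: "N * L \<le> 315 * (N * l)" using L_bounds(3) N_pos by simp
  have Nl: "N \<le> 3 * (N * l)" using l_ge N_pos by simp
  then have "exp 244 * N \<le> exp 244 * (3 * (N * l))" by (intro mult_left_mono) auto
  then have ENl: "exp 244 * N \<le> 3 * (exp 244 * (N * l))" by simp
  have nonneg: "0 \<le> Q * lam\<^sup>2" "0 \<le> N * l" "0 \<le> exp 244 * (N * l)"
    using Q_ge N_pos l_ge by simp_all
  \<comment> \<open>Here \<open>921600 = 128 * 7200\<close> and \<open>512 = 128 * 4\<close>, while
    800 and 12 are twice the constants of the remainder.\<close>
  have "minor_integral (\<lambda>n. of_nat (\<omega> n)) N K Q0 Q \<le>
      921600 * (Q * lam\<^sup>2) + 512 * N + 800 * (exp 244 * N) + 12 * (N * L)"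
    using 1 2 3 by simp
  also have "\<dots> \<le> 1000000 * (Q * lam\<^sup>2) + 10000 * (N * l) + 3000 * (exp 244 * (N * l))"
    using NL Nl ENl nonneg by linarith
  finally show ?thesis by (simp add: distrib_right)
qed

text \<open>With \<open>t = 1 / R\<close>, the model is \<open>(1 + t) powr L\<close> times the
  second-order expansion of \<open>(1 + t) ^ omega_low n\<close>. The linear error is controlled by
  the excess and variance moments and carries \<open>t\<^sup>2\<close>; the cubic error carries
  \<open>t ^ 6 * lam ^ 6\<close>, which is at most \<open>t\<^sup>2\<close> by
  \<open>lam ^ 3 \<le> R\<^sup>2\<close>.\<close>

lemma minor_integral_power_omega_le:
  fixes R :: real
  assumes \<omega>: "\<omega> \<in> {little_omega, big_omega}"
    and R: "lam \<le> \<bar>R\<bar>" "lam ^ 3 \<le> R\<^sup>2"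
  defines "C \<equiv> 16 * exp 120 * (600 * exp 244 + 945 * exp 960 + 600 * exp 4) + 6 * 46656 * exp 484"
  shows "minor_integral (\<lambda>n. of_real ((1 + 1 / R) ^ \<omega> n)) N K Q0 Q \<le>
           256 * exp 120 * Q + (2 * C + 6144 * exp 120) * (N / R\<^sup>2 * l)"
proof -
  define P where "P = primes_in 1 y"
  define t where "t = 1 / R"
  define \<beta> where "\<beta> = ln (1 + t)"
  define c where "c = exp (L * \<beta>)"
  define T where "T = (\<lambda>m. \<Sum>k\<le>2. real (m choose k) * t ^ k)"
  \<comment> \<open>A set \<open>S\<close> stands for the squarefree divisor
    \<open>\<Prod>S\<close>, at most \<open>y\<^sup>2\<close>.\<close>
  define I where "I = {S. S \<subseteq> P \<and> card S \<le> 2}"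
  define h where "h = (\<lambda>n. (1 + t) ^ \<omega> n - c * T (omega_low n))"
  have R0: "R \<noteq> 0" "40 \<le> \<bar>R\<bar>" using R lam_ge by auto
  have tR: "\<bar>t\<bar> = 1 / \<bar>R\<bar>" "t\<^sup>2 = 1 / R\<^sup>2" by (simp_all add: t_def power_divide)
  have t: "\<bar>t\<bar> \<le> 1/40" "\<bar>t\<bar> \<le> 1 / lam"
    unfolding tR using R R0 lam_ge by (intro divide_left_mono; simp)+
  have \<beta>: "\<bar>\<beta>\<bar> \<le> 2 * \<bar>t\<bar>" "\<beta> \<le> \<bar>t\<bar>"
    using abs_ln_one_plus_le[of t] t by (simp_all add: \<beta>_def)
  have pow: "(1 + t) ^ m = exp (real m * \<beta>)" for m
    using t by (simp add: \<beta>_def exp_of_nat_mult)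
  have Lt: "L * \<bar>t\<bar> \<le> 60"
  proof -
    have "L * \<bar>t\<bar> \<le> (60 * lam) * (1 / lam)" using L_bounds t by (intro mult_mono) auto
    then show ?thesis using lam_ge by simp
  qed
  have "L * \<beta> \<le> L * \<bar>t\<bar>" using L_bounds \<beta> by (intro mult_left_mono) auto
  then have c: "c \<le> exp 60" "0 \<le> c" using Lt by (simp_all add: c_def)
  have fin: "finite P" by (simp add: P_def)
  have finI: "finite I" unfolding I_def by (rule finite_subset[of _ "Pow P"]) (use fin in auto)

  have main: "minor_integral (\<lambda>n. of_real ((1 + 1 / R) ^ \<omega> n)) N K Q0 Q \<le>
      128 * Q * (\<Sum>S\<in>I. \<bar>c * t ^ card S\<bar>)\<^sup>2 + 2 * (\<Sum>n=1..nat \<lfloor>N\<rfloor>. (h n)\<^sup>2)"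
  proof (rule minor_integral_le[where d = "\<lambda>S. \<Prod>S"])
    fix S assume "S \<in> I"
    then have S: "S \<subseteq> P" "card S \<le> 2" by (auto simp: I_def)
    have "0 < \<Prod>S" using S by (intro prod_pos) (auto simp: P_def primes_in_def prime_gt_0_nat)
    moreover have "real (\<Prod>S) \<le> K * Q0"
    proof -
      have "real (\<Prod>S) = (\<Prod>p\<in>S. real p)" by simp
      also have "\<dots> \<le> (\<Prod>p\<in>S. y)" using S by (intro prod_mono) (auto simp: P_def primes_in_def)
      also have "\<dots> = y ^ card S" by simp
      also have "\<dots> \<le> y\<^sup>2" using S y_bounds by (intro power_increasing) auto
      finally show ?thesis using y_bounds w_le_KQ0 by linarith
    qed
    ultimately show "0 < \<Prod>S \<and> real (\<Prod>S) \<le> K * Q0" by simp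
  next
    fix n
    have "{S. S \<in> I \<and> \<Prod>S dvd n} = {S. S \<subseteq> {p \<in> P. p dvd n} \<and> card S \<le> 2}"
    proof (intro equalityI subsetI)
      fix S assume S: "S \<in> {S. S \<in> I \<and> \<Prod>S dvd n}"
      then have "finite S" using fin by (auto simp: I_def intro: finite_subset)
      then have "p dvd n" if "p \<in> S" for p
        using S that dvd_prodI[of S p id] by (auto intro: dvd_trans)
      then show "S \<in> {S. S \<subseteq> {p \<in> P. p dvd n} \<and> card S \<le> 2}" using S by (auto simp: I_def)
    next
      fix S assume S: "S \<in> {S. S \<subseteq> {p \<in> P. p dvd n} \<and> card S \<le> 2}"
      then have "finite S" using fin by (auto intro: finite_subset)
      then have "\<Prod>S dvd n" using S by (intro prod_primes_dvd) (auto simp: P_def primes_in_def)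
      then show "S \<in> {S. S \<in> I \<and> \<Prod>S dvd n}" using S by (auto simp: I_def)
    qed
    then have "(\<Sum>S | S \<in> I \<and> \<Prod>S dvd n. c * t ^ card S) = c * T (omega_low n)"
      using fin sum_small_subsets[of "{p \<in> P. p dvd n}" "\<lambda>k. c * t ^ k" 2]
      by (simp add: T_def omega_on_def P_def sum_distrib_left mult_ac)
    then show "of_real ((1 + 1 / R) ^ \<omega> n) = complex_of_real ((\<Sum>S | S \<in> I \<and> \<Prod>S dvd n. c * t ^ card S) + h n)"
      by (simp add: h_def t_def)
  qed (use finI K Q_ge in auto)

  have "(\<Sum>S\<in>I. \<bar>c * t ^ card S\<bar>) = c * (\<Sum>k\<le>2. real (card P choose k) * \<bar>t\<bar> ^ k)"
    using sum_small_subsets[OF fin, of "\<lambda>k. c * \<bar>t\<bar> ^ k" 2] c(2)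
    by (simp add: I_def abs_mult power_abs sum_distrib_left mult_ac)
  \<comment> \<open>One factor \<open>\<bar>t\<bar>\<close> is kept in both the linear and the
    quadratic term, so that squaring gives \<open>y ^ 4 * t\<^sup>2 = w * t\<^sup>2\<close>.\<close>
  also have "\<dots> \<le> exp 60 * (1 + 2 * y\<^sup>2 * \<bar>t\<bar>)"
  proof (intro mult_mono c)
    have cP: "real (card P) \<le> y" using card_low by (simp add: P_def)
    have "real (card P choose 2) \<le> real (card P * (card P - 1))"
      unfolding choose_two of_nat_le_iff by simp
    also have "\<dots> \<le> (real (card P))\<^sup>2"
      unfolding of_nat_mult power2_eq_square by (intro mult_left_mono) auto
    also have "\<dots> \<le> y\<^sup>2" using cP by (intro power_mono) auto
    finally have "real (card P choose 2) * (\<bar>t\<bar> * \<bar>t\<bar>) \<le> y\<^sup>2 * (\<bar>t\<bar> * 1)"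
      using t by (intro mult_mono) auto
    moreover have "real (card P) * \<bar>t\<bar> \<le> y\<^sup>2 * \<bar>t\<bar>"
      using cP y_bounds by (intro mult_right_mono) auto
    ultimately show "(\<Sum>k\<le>2. real (card P choose k) * \<bar>t\<bar> ^ k) \<le> 1 + 2 * y\<^sup>2 * \<bar>t\<bar>"
      by (simp add: numeral_2_eq_2)
    show "0 \<le> (\<Sum>k\<le>2. real (card P choose k) * \<bar>t\<bar> ^ k)" by (intro sum_nonneg) auto
  qed auto
  finally have "(\<Sum>S\<in>I. \<bar>c * t ^ card S\<bar>)\<^sup>2 \<le> (exp 60 * (1 + 2 * y\<^sup>2 * \<bar>t\<bar>))\<^sup>2"
    by (intro power_mono sum_nonneg) auto
  also have "\<dots> = exp 120 * (1 + 2 * y\<^sup>2 * \<bar>t\<bar>)\<^sup>2"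
    by (simp add: power_mult_distrib flip: exp_of_nat_mult)
  also have "\<dots> \<le> exp 120 * (2 * 1\<^sup>2 + 2 * (2 * y\<^sup>2 * \<bar>t\<bar>)\<^sup>2)"
    by (intro mult_left_mono square_add_le) auto
  also have "(2 * y\<^sup>2 * \<bar>t\<bar>)\<^sup>2 = 4 * w * t\<^sup>2"
    using y_bounds(2) by (simp add: power_mult_distrib flip: power_mult)
  finally have "Q * (\<Sum>S\<in>I. \<bar>c * t ^ card S\<bar>)\<^sup>2 \<le> Q * (exp 120 * (2 * 1\<^sup>2 + 2 * (4 * w * t\<^sup>2)))"
    using Q_ge by (intro mult_left_mono) auto
  also have "\<dots> = 2 * exp 120 * Q + 8 * exp 120 * t\<^sup>2 * (w * Q)"
    by (simp add: algebra_simps)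
  also have "8 * exp 120 * t\<^sup>2 * (w * Q) = 16 * exp 120 * (N * t\<^sup>2)"
    unfolding w_bounds(4) by simp
  finally have low: "Q * (\<Sum>S\<in>I. \<bar>c * t ^ card S\<bar>)\<^sup>2 \<le> 2 * exp 120 * Q + 16 * exp 120 * (N * t\<^sup>2)" .

  define X where "X = (\<lambda>n. (real (big_omega n) - little_omega n)\<^sup>2 * exp (2 * big_omega n / lam))"
  define Y where "Y = (\<lambda>n. (real (omega_high n) - L)\<^sup>2 * exp (2 * big_omega n / lam))"
  define Z where "Z = (\<lambda>n. real (little_omega n) ^ 6 * exp (2 * little_omega n / lam))"
  have h: "(h n)\<^sup>2 \<le> 16 * t\<^sup>2 * exp 120 * X n + 16 * t\<^sup>2 * exp 120 * Y n + 2 * exp 120 * t ^ 6 * Z n"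
    if n: "n \<in> {1..nat \<lfloor>N\<rfloor>}" for n
  proof -
    define a where "a = real (\<omega> n) - little_omega n"
    define b where "b = real (omega_high n) - L"
    define W where "W = real (big_omega n)"
    define v where "v = real (omega_low n)"
    have lo: "real (little_omega n) = v + real (omega_high n)"
      using little_omega_split[OF n] by (simp add: v_def)
    have ex: "real (little_omega n) \<le> real (\<omega> n)" "real (\<omega> n) \<le> W"
      using excess_bounds[OF \<omega>, of n] by (simp_all add: W_def)
    have v0: "0 \<le> v" "v \<le> real (little_omega n)" "v \<le> W" using lo ex by (simp_all add: v_def)
    have scale: "m * \<bar>t\<bar> \<le> m / lam" if "0 \<le> m" for m
      using mult_left_mono[OF t(2) that] by simp
    have diff: "real (\<omega> n) * \<beta> - (v + L) * \<beta> = (a + b) * \<beta>"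
      using lo by (simp add: a_def b_def algebra_simps)
    \<comment> \<open>The true and the model exponent obey the same bound; 60 is the bound for
      \<open>L * \<bar>t\<bar>\<close>.\<close>
    have mx: "max (real (\<omega> n) * \<beta>) ((v + L) * \<beta>) \<le> W / lam + 60"
    proof (rule max.boundedI)
      have "real (\<omega> n) * \<beta> \<le> real (\<omega> n) * \<bar>t\<bar>" using \<beta> by (intro mult_left_mono) auto
      also have "\<dots> \<le> W * \<bar>t\<bar>" using ex by (intro mult_right_mono) auto
      finally show "real (\<omega> n) * \<beta> \<le> W / lam + 60" using scale[of W] v0 by linarith
      have "(v + L) * \<beta> \<le> (v + L) * \<bar>t\<bar>" using \<beta> v0 L_bounds by (intro mult_left_mono) auto
      also have "\<dots> = v * \<bar>t\<bar> + L * \<bar>t\<bar>" by (simp add: algebra_simps)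
      also have "\<dots> \<le> W * \<bar>t\<bar> + 60" using v0 Lt by (intro add_mono mult_right_mono) auto
      finally show "(v + L) * \<beta> \<le> W / lam + 60" using scale[of W] v0 by linarith
    qed
    \<comment> \<open>\<open>D\<close> is the error of replacing the large and repeated primes by
      the mean \<open>L\<close>, \<open>E\<close> that of truncating the expansion over the small
      primes.\<close>
    define D where "D = exp (real (\<omega> n) * \<beta>) - exp ((v + L) * \<beta>)"
    define E where "E = c * ((1 + t) ^ omega_low n - T (omega_low n))"
    have hDE: "h n = D + E"
      unfolding h_def D_def E_def pow c_def v_def by (simp add: algebra_simps exp_add)
    have "\<bar>D\<bar> \<le> \<bar>(a + b) * \<beta>\<bar> * exp (max (real (\<omega> n) * \<beta>) ((v + L) * \<beta>))"
      unfolding D_def diff[symmetric] by (rule abs_exp_diff_le)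
    also have "\<dots> \<le> \<bar>a + b\<bar> * (2 * \<bar>t\<bar>) * exp (W / lam + 60)"
      unfolding abs_mult using \<beta> mx by (intro mult_mono) auto
    finally have "\<bar>D\<bar>\<^sup>2 \<le> (\<bar>a + b\<bar> * (2 * \<bar>t\<bar>) * exp (W / lam + 60))\<^sup>2"
      by (intro power_mono) auto
    also have "\<dots> = (a + b)\<^sup>2 * (4 * t\<^sup>2) * (exp 120 * exp (2 * W / lam))"
      by (simp add: power_mult_distrib exp_add flip: exp_of_nat_mult)
    also have "\<dots> \<le> (2 * a\<^sup>2 + 2 * b\<^sup>2) * (4 * t\<^sup>2) * (exp 120 * exp (2 * W / lam))"
      by (intro mult_right_mono square_add_le) auto
    also have "\<dots> \<le> (2 * (W - real (little_omega n))\<^sup>2 + 2 * b\<^sup>2) * (4 * t\<^sup>2) * (exp 120 * exp (2 * W / lam))"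
      using ex by (intro mult_right_mono add_mono mult_left_mono power_mono) (auto simp: a_def)
    also have "\<dots> = 8 * t\<^sup>2 * exp 120 * X n + 8 * t\<^sup>2 * exp 120 * Y n"
      by (simp add: X_def Y_def W_def b_def algebra_simps)
    finally have D: "D\<^sup>2 \<le> 8 * t\<^sup>2 * exp 120 * X n + 8 * t\<^sup>2 * exp 120 * Y n" by simp
    have "\<bar>E\<bar> \<le> exp 60 * ((v * \<bar>t\<bar>) ^ 3 * exp (v * \<bar>t\<bar>))"
      unfolding E_def abs_mult T_def v_def using c
      by (intro mult_mono binomial_remainder_le) auto
    also have "\<dots> \<le> exp 60 * ((real (little_omega n) * \<bar>t\<bar>) ^ 3 * exp (little_omega n / lam))"
    proof (intro mult_left_mono mult_mono power_mono)
      show "exp (v * \<bar>t\<bar>) \<le> exp (little_omega n / lam)"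
        using scale[OF v0(1)] v0 lam_ge divide_right_mono[OF v0(2), of lam] by simp
    qed (use v0 in \<open>auto intro: mult_right_mono\<close>)
    finally have "\<bar>E\<bar>\<^sup>2 \<le> (exp 60 * ((real (little_omega n) * \<bar>t\<bar>) ^ 3 * exp (little_omega n / lam)))\<^sup>2"
      by (intro power_mono) auto
    also have "\<dots> = exp 120 * t ^ 6 * Z n"
      by (simp add: Z_def power_mult_distrib mult_ac flip: exp_of_nat_mult power_mult)
    finally have E: "E\<^sup>2 \<le> exp 120 * t ^ 6 * Z n" by simp
    show ?thesis using square_add_le[of D E] D E by (simp add: hDE)
  qed
  \<comment> \<open>This is \<open>t\<^sup>2\<close> times the square of
    \<open>t\<^sup>2 * lam ^ 3 \<le> 1\<close>.\<close>
  have t6: "t ^ 6 * lam ^ 6 \<le> t\<^sup>2"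
  proof -
    have "t\<^sup>2 * lam ^ 3 \<le> 1" using R R0 by (simp add: tR field_simps)
    then have "(t\<^sup>2 * lam ^ 3)\<^sup>2 \<le> 1\<^sup>2" using lam_ge by (intro power_mono) auto
    then have "t\<^sup>2 * (t\<^sup>2 * lam ^ 3)\<^sup>2 \<le> t\<^sup>2 * 1" by (intro mult_left_mono) auto
    then show ?thesis by (simp add: power_mult_distrib mult_ac flip: power_mult power_add)
  qed
  have "(\<Sum>n=1..nat \<lfloor>N\<rfloor>. (h n)\<^sup>2) \<le> (\<Sum>n=1..nat \<lfloor>N\<rfloor>.
     16 * t\<^sup>2 * exp 120 * X n + 16 * t\<^sup>2 * exp 120 * Y n + 2 * exp 120 * t ^ 6 * Z n)"
    by (intro sum_mono h)
  also have "\<dots> = 16 * t\<^sup>2 * exp 120 * (\<Sum>n=1..nat \<lfloor>N\<rfloor>. X n) + 16 * t\<^sup>2 * exp 120 * (\<Sum>n=1..nat \<lfloor>N\<rfloor>. Y n)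
      + 2 * exp 120 * t ^ 6 * (\<Sum>n=1..nat \<lfloor>N\<rfloor>. Z n)"
    by (simp only: sum.distrib sum_distrib_left)
  also have "\<dots> \<le> 16 * t\<^sup>2 * exp 120 * (200 * exp 244 * N) + 16 * t\<^sup>2 * exp 120 * ((3 * exp 960 * L + 200 * exp 4) * N)
      + 2 * exp 120 * t ^ 6 * (46656 * exp 364 * lam ^ 6 * N)"
    unfolding X_def Y_def Z_def
    by (intro add_mono mult_left_mono excess_moment weighted_variance_le sixth_moment) auto
  also have "2 * exp 120 * t ^ 6 * (46656 * exp 364 * lam ^ 6 * N) = 2 * 46656 * (exp 120 * exp 364) * N * (t ^ 6 * lam ^ 6)"
    by (simp only: mult_ac)
  also have "exp 120 * exp 364 = (exp 484 :: real)" by (simp flip: exp_add)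
  also have "16 * t\<^sup>2 * exp 120 * (200 * exp 244 * N) + 16 * t\<^sup>2 * exp 120 * ((3 * exp 960 * L + 200 * exp 4) * N)
      + 2 * 46656 * exp 484 * N * (t ^ 6 * lam ^ 6) \<le>
      16 * t\<^sup>2 * exp 120 * (200 * exp 244 * (3 * (N * l))) + 16 * t\<^sup>2 * exp 120 * (3 * exp 960 * (315 * (N * l)) + 200 * exp 4 * (3 * (N * l)))
      + 2 * 46656 * exp 484 * (3 * (N * l)) * t\<^sup>2"
  proof -
    have NL: "L * N \<le> 315 * (N * l)" using L_bounds(3) N_pos by (simp add: mult.commute)
    have Nl: "N \<le> 3 * (N * l)" using l_ge N_pos by simp
    have 1: "200 * exp 244 * N \<le> 200 * exp 244 * (3 * (N * l))" using Nl by (intro mult_left_mono) auto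
    have "3 * exp 960 * (L * N) \<le> 3 * exp 960 * (315 * (N * l))" using NL by (intro mult_left_mono) auto
    moreover have "200 * exp 4 * N \<le> 200 * exp 4 * (3 * (N * l))" using Nl by (intro mult_left_mono) auto
    ultimately have 2: "(3 * exp 960 * L + 200 * exp 4) * N \<le> 3 * exp 960 * (315 * (N * l)) + 200 * exp 4 * (3 * (N * l))"
      unfolding distrib_right mult.assoc by (rule add_mono)
    have 3: "2 * 46656 * exp 484 * N * (t ^ 6 * lam ^ 6) \<le> 2 * 46656 * exp 484 * (3 * (N * l)) * t\<^sup>2"
      using Nl N_pos l_ge lam_ge by (intro mult_mono t6) auto
    show ?thesis by (intro add_mono mult_left_mono 1 2 3) auto
  qed
  also have "\<dots> = C * (N * t\<^sup>2 * l)"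
  proof -
    \<comment> \<open>Variables replace the exponentials, so that only a polynomial identity
      remains.\<close>
    have "16 * s * a * (200 * b * (3 * (N * l))) + 16 * s * a * (3 * c * (315 * (N * l)) + 200 * d * (3 * (N * l)))
        + 2 * 46656 * e * (3 * (N * l)) * s = (16 * a * (600 * b + 945 * c + 600 * d) + 6 * 46656 * e) * (N * s * l)"
      for s a b c d e :: real by (simp add: algebra_simps)
    then show ?thesis unfolding C_def .
  qed
  finally have high: "(\<Sum>n=1..nat \<lfloor>N\<rfloor>. (h n)\<^sup>2) \<le> C * (N * t\<^sup>2 * l)" .
  have Ntl: "N * t\<^sup>2 \<le> 3 * (N * t\<^sup>2 * l)"
    using l_ge N_pos mult_left_mono[of 1 "3 * l" "N * t\<^sup>2"] by simp
  have "minor_integral (\<lambda>n. of_real ((1 + 1 / R) ^ \<omega> n)) N K Q0 Q \<le>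
      128 * (2 * exp 120 * Q + 16 * exp 120 * (N * t\<^sup>2)) + 2 * (C * (N * t\<^sup>2 * l))"
    by (rule order_trans[OF main], unfold mult.assoc[of 128 Q], intro add_mono mult_left_mono low high) simp_all
  also have "\<dots> \<le> 128 * (2 * exp 120 * Q + 16 * exp 120 * (3 * (N * t\<^sup>2 * l))) + 2 * (C * (N * t\<^sup>2 * l))"
    by (intro add_mono mult_left_mono order_refl Ntl) auto
  also have "\<dots> = 256 * exp 120 * Q + (2 * C + 6144 * exp 120) * (N / R\<^sup>2 * l)"
  proof -
    have "128 * (2 * E * Q + 16 * E * (3 * X)) + 2 * (C * X) = 256 * E * Q + (2 * C + 6144 * E) * X"
      for E X :: real by (simp add: algebra_simps)
    then show ?thesis by (simp only: tR(2) times_divide_eq_right mult_1_right)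
  qed
  finally show ?thesis .
qed

end

section \<open>Choice of the constants and assembly of the bounds\<close>

theorem proposition3p6:
  shows "\<exists>K0>0. \<exists>\<delta>0>0. \<exists>Cd>0. \<forall>\<delta>. 0 < \<delta> \<and> \<delta> \<le> \<delta>0 \<longrightarrow>
    (\<exists>Cc>0. \<exists>N0>0. \<forall>K\<ge>K0. \<exists>B>0.
      \<forall>(N::real) (Q::real) (Q0::real). N0 \<le> N \<and> admissible K \<delta> N Q Q0 \<longrightarrow>
        minor_integral (\<lambda>n. 1) N K Q0 Q \<le> B * Q
      \<and> (\<forall>w \<in> {little_omega, big_omega}.
           K * Q0 < N powr (1/2 - \<delta>/2) \<longrightarrow>
           minor_integral (\<lambda>n. of_nat (w n)) N K Q0 Q
             \<le> B * (Q * (ln (ln N))\<^sup>2 + N * ln (ln N / ln (2 * N / Q))))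
      \<and> (\<forall>w \<in> {little_omega, big_omega}. \<forall>R :: real \<Rightarrow> real.
           R N \<noteq> 0 \<and> K * Q0 < N powr (1/2 - \<delta>/2) \<and>
           Cc * ln (ln N) < \<bar>R N\<bar> \<and> \<bar>R N\<bar> \<le> N powr (\<delta>/12) \<and>
           ln (ln N) powr (3/2) < \<bar>R N\<bar> \<longrightarrow>
           minor_integral (\<lambda>n. of_real ((1 + 1 / R N) ^ w n)) N K Q0 Q
             \<le> B * (N / (R N)\<^sup>2 * ln (ln N / ln (2 * N / Q)) + Q))
      \<and> (\<forall>y u :: real. 1 < y \<and> u = ln N / ln y \<and>
           K * Q0 \<le> N powr (1/2 - \<delta>) * (ln N) ^ 17 \<and>
           1 + ln Cd / ln N \<le> u \<and> u \<le> 2 \<longrightarrow>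
           minor_integral (smooth_indicator y) N K Q0 Q \<le> B * (N * ln u + Q)))"
proof -
  define C :: real where
    "C = 16 * exp 120 * (600 * exp 244 + 945 * exp 960 + 600 * exp 4) + 6 * 46656 * exp 484"
  \<comment> \<open>One constant dominating those of all four bounds; it depends on neither
    \<open>K\<close> nor \<open>\<delta>\<close>.\<close>
  define B :: real where "B = 1000000 + 3000 * exp 244 + 256 * exp 120 + (2 * C + 6144 * exp 120)"
  have C0: "0 \<le> C" unfolding C_def by (intro add_nonneg_nonneg mult_nonneg_nonneg) auto
  have B: "0 < B" "1000000 \<le> B" "10000 + 3000 * exp 244 \<le> B" "256 * exp 120 \<le> B" "2 * C + 6144 * exp 120 \<le> B"
    using C0 exp_ge_zero[of "244::real"] exp_ge_zero[of "120::real"] unfolding B_def by linarith+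
  \<comment> \<open>The conclusion with the witnesses already inserted; \<open>1 * ln (ln N)\<close>
    keeps the literal form of \<open>Cc * ln (ln N)\<close> at \<open>Cc = 1\<close>.\<close>
  have key: "minor_integral (\<lambda>n. 1) N K Q0 Q \<le> B * Q
      \<and> (\<forall>w \<in> {little_omega, big_omega}.
           K * Q0 < N powr (1/2 - \<delta>/2) \<longrightarrow>
           minor_integral (\<lambda>n. of_nat (w n)) N K Q0 Q
             \<le> B * (Q * (ln (ln N))\<^sup>2 + N * ln (ln N / ln (2 * N / Q))))
      \<and> (\<forall>w \<in> {little_omega, big_omega}. \<forall>R :: real \<Rightarrow> real.
           R N \<noteq> 0 \<and> K * Q0 < N powr (1/2 - \<delta>/2) \<and>
           1 * ln (ln N) < \<bar>R N\<bar> \<and> \<bar>R N\<bar> \<le> N powr (\<delta>/12) \<and>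
           ln (ln N) powr (3/2) < \<bar>R N\<bar> \<longrightarrow>
           minor_integral (\<lambda>n. of_real ((1 + 1 / R N) ^ w n)) N K Q0 Q
             \<le> B * (N / (R N)\<^sup>2 * ln (ln N / ln (2 * N / Q)) + Q))
      \<and> (\<forall>y u :: real. 1 < y \<and> u = ln N / ln y \<and>
           K * Q0 \<le> N powr (1/2 - \<delta>) * (ln N) ^ 17 \<and>
           1 + ln 4 / ln N \<le> u \<and> u \<le> 2 \<longrightarrow>
           minor_integral (smooth_indicator y) N K Q0 Q \<le> B * (N * ln u + Q))"
    if \<delta>: "0 < \<delta>" and K: "1 \<le> K" and N: "exp (exp 40) \<le> N" and adm: "admissible K \<delta> N Q Q0"
    for \<delta> K N Q Q0
  proof -
    have N1: "1 < N" using N exp_gt_zero[of "40::real"] one_less_exp_iff[of "exp 40::real"] by linarith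
    interpret minor_arc_parameters N K Q Q0
    proof
      have "sqrt N \<le> N powr (1/2 + \<delta>)"
        using N1 \<delta> powr_mono[of "1/2" "1/2 + \<delta>" N] by (simp add: powr_half_sqrt)
      then show "sqrt N \<le> Q" using adm by (simp add: admissible_def)
    qed (use N K adm in \<open>auto simp: admissible_def\<close>)
    have l: "l = ln (ln N / ln (2 * N / Q))" by (simp add: l_def w_def)
    have Nl: "0 \<le> N * l" "0 \<le> Q" "0 \<le> Q * lam\<^sup>2" using N_pos l_ge Q_ge by simp_all
    have B128: "128 \<le> B" "48 \<le> B" using B(2) by linarith+
    have a: "minor_integral (\<lambda>n. 1) N K Q0 Q \<le> B * Q"
      by (rule order_trans[OF minor_integral_one_le mult_right_mono[OF B128(1) Nl(2)]])
    have b: "minor_integral (\<lambda>n. of_nat (\<omega> n)) N K Q0 Q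
             \<le> B * (Q * (ln (ln N))\<^sup>2 + N * ln (ln N / ln (2 * N / Q)))"
      if \<omega>: "\<omega> \<in> {little_omega, big_omega}" for \<omega>
    proof -
      note minor_integral_omega_le[OF \<omega>]
      also have "1000000 * (Q * lam\<^sup>2) + (10000 + 3000 * exp 244) * (N * l) \<le> B * (Q * lam\<^sup>2) + B * (N * l)"
        by (intro add_mono mult_right_mono B Nl)
      also have "\<dots> = B * (Q * (ln (ln N))\<^sup>2 + N * ln (ln N / ln (2 * N / Q)))"
        by (simp only: l lam_def distrib_left)
      finally show ?thesis .
    qed
    have c: "minor_integral (\<lambda>n. of_real ((1 + 1 / R) ^ \<omega> n)) N K Q0 Q
             \<le> B * (N / R\<^sup>2 * ln (ln N / ln (2 * N / Q)) + Q)"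
      if \<omega>: "\<omega> \<in> {little_omega, big_omega}"
        and R: "1 * ln (ln N) < \<bar>R\<bar>" "ln (ln N) powr (3/2) < \<bar>R\<bar>" for \<omega> R
    proof -
      \<comment> \<open>Squaring the hypothesis with exponent 3/2 gives the form used against the
        cubic remainder.\<close>
      have "lam ^ 3 = (lam powr (3/2))\<^sup>2"
        using lam_ge powr_add[of lam "3/2" "3/2"] by (simp add: power2_eq_square)
      also have "\<dots> \<le> \<bar>R\<bar>\<^sup>2" using R by (intro power_mono) (auto simp: lam_def)
      finally have R3: "lam ^ 3 \<le> R\<^sup>2" by simp
      have R1: "lam \<le> \<bar>R\<bar>" using R(1) by (simp add: lam_def)
      have NR: "0 \<le> N / R\<^sup>2 * l" using N_pos l_ge by simp
      note minor_integral_power_omega_le[OF \<omega> R1 R3, folded C_def]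
      also have "256 * exp 120 * Q + (2 * C + 6144 * exp 120) * (N / R\<^sup>2 * l) \<le> B * Q + B * (N / R\<^sup>2 * l)"
        by (intro add_mono mult_right_mono B Nl NR)
      also have "\<dots> = B * (N / R\<^sup>2 * ln (ln N / ln (2 * N / Q)) + Q)"
        by (simp only: l distrib_left add.commute)
      finally show ?thesis .
    qed
    have d: "minor_integral (smooth_indicator z) N K Q0 Q \<le> B * (N * ln u + Q)"
      if z: "1 < z" "u = ln N / ln z" "1 + ln 4 / ln N \<le> u" "u \<le> 2" for z u
    proof -
      have "0 < ln 4 / ln N" using ln_N by simp
      then have "1 \<le> u" using z(3) by linarith
      then have Nu: "0 \<le> N * ln u" using N_pos by simp
      note minor_integral_smooth_le[OF z(1,3,4,2)]
      also have "128 * Q + 48 * N * ln u \<le> B * Q + B * (N * ln u)"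
        unfolding mult.assoc by (intro add_mono mult_right_mono B128 Nl Nu)
      also have "\<dots> = B * (N * ln u + Q)" by (simp only: distrib_left add.commute)
      finally show ?thesis .
    qed
    show ?thesis
      by (intro conjI ballI allI impI a b c d) simp_all
  qed
  show ?thesis
  \<comment> \<open>The witnesses are \<open>K0 = 1\<close>, \<open>\<delta>0 = 1\<close>,
    \<open>Cd = 4\<close>, \<open>Cc = 1\<close> and \<open>N0 = exp (exp 40)\<close>; the 4 is the
    one in \<open>ln 4\<close> of the smooth case.\<close>
  proof (rule exI[of _ 1], rule conjI[OF zero_less_one], rule exI[of _ 1], rule conjI[OF zero_less_one],
      rule exI[of _ 4], rule conjI[OF zero_less_numeral], intro allI impI,
      rule exI[of _ 1], rule conjI[OF zero_less_one], rule exI[of _ "exp (exp 40)"], rule conjI[OF exp_gt_zero],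
      intro allI impI, rule exI[of _ B], rule conjI[OF B(1)], intro allI impI)
    fix \<delta> K N Q Q0 :: real
    assume "0 < \<delta> \<and> \<delta> \<le> 1" "1 \<le> K" "exp (exp 40) \<le> N \<and> admissible K \<delta> N Q Q0"
    then show "minor_integral (\<lambda>n. 1) N K Q0 Q \<le> B * Q
        \<and> (\<forall>w \<in> {little_omega, big_omega}.
             K * Q0 < N powr (1/2 - \<delta>/2) \<longrightarrow>
             minor_integral (\<lambda>n. of_nat (w n)) N K Q0 Q
               \<le> B * (Q * (ln (ln N))\<^sup>2 + N * ln (ln N / ln (2 * N / Q))))
        \<and> (\<forall>w \<in> {little_omega, big_omega}. \<forall>R :: real \<Rightarrow> real.
             R N \<noteq> 0 \<and> K * Q0 < N powr (1/2 - \<delta>/2) \<and>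
             1 * ln (ln N) < \<bar>R N\<bar> \<and> \<bar>R N\<bar> \<le> N powr (\<delta>/12) \<and>
             ln (ln N) powr (3/2) < \<bar>R N\<bar> \<longrightarrow>
             minor_integral (\<lambda>n. of_real ((1 + 1 / R N) ^ w n)) N K Q0 Q
               \<le> B * (N / (R N)\<^sup>2 * ln (ln N / ln (2 * N / Q)) + Q))
        \<and> (\<forall>y u :: real. 1 < y \<and> u = ln N / ln y \<and>
             K * Q0 \<le> N powr (1/2 - \<delta>) * (ln N) ^ 17 \<and>
             1 + ln 4 / ln N \<le> u \<and> u \<le> 2 \<longrightarrow>
             minor_integral (smooth_indicator y) N K Q0 Q \<le> B * (N * ln u + Q))"
      by (intro key) simp_all
  qed
qed

end
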